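(* Let $D$ be an integral domain that is not a field. If $D$ is Clifford $w$-regular, then each nonzero extended ideal of $D[X]$ is $w$-regular and each nonzero extended ideal of $\mathrm{Na}(D,v)$ is vN-regular. If $D$ is $w$-stable, then each nonzero extended ideal of $D[X]$ is $w$-stable and each nonzero extended ideal of $\mathrm{Na}(D,v)$ is stable.
   Context: For an integral domain $D$ with field of fractions $K$, "ideal" means fractional ideal, an integral ideal is an ideal contained in $D$, and $\mathcal{F}(D)$ is the set of nonzero ideals. For ideals $I,J$, $(J:I)=\{x\in K: xI\subseteq J\}$. For $I\in\mathcal F(D)$: $I^v=(D:(D:I))$; $I^t=\bigcup\{J^v: J\in\mathcal F(D)\text{ finitely generated}, J\subseteq I\}$; $I$ is a $t$-ideal if $I=I^t$; a $t$-maximal ideal is an ideal maximal among the proper integral $t$-ideals (it is prime), and $t\text{-Max}(D)$ is the set of these; $I^w=\bigcap_{M\in t\text{-Max}(D)}ID_M$, equivalently $I^w=\bigcup\{(I:J): J\text{ finitely generated},(D:J)=D\}$. These are defined for every domain (e.g. $D[X]$, with its own $w$-operation). For $I\in\mathcal F(D)$ put $E(I)=(I:I)$. $I$ is stable if $I(E(I):I)=E(I)$. $I$ is $w$-stable if, with $E=E(I^w)$, $(I^w(E:I^w))^w=E$ ($w$ being the $w$-operation of $D$); $D$ is $w$-stable if every nonzero ideal is $w$-stable. $I$ is vN-regular if $I=I^2J$ for some nonzero ideal $J$. $I$ is $w$-regular if $I^w=(I^2J)^w$ for some nonzero ideal $J$; $D$ is Clifford $w$-regular if every nonzero ideal is $w$-regular.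 The same definitions apply to ideals of any domain. $X$ is an indeterminate, $c(h)$ is the ideal of $D$ generated by the coefficients of $h\in D[X]$. $\mathrm{Na}(D,v)=D[X]_{N(v)}$ with $N(v)=\{h\in D[X]: h\neq0,\ c(h)^v=D\}$. An extended ideal of an extension ring $T$ of $D$ (here $T=D[X]$ or $\mathrm{Na}(D,v)$) is one of the form $IT$ with $I$ an ideal of $D$. *)

theory Defs
  imports "HOL-Computational_Algebra.Polynomial_Factorial"
begin

text \<open>
  An integral domain is represented as a subring \<open>R\<close> of some ambient field \<open>'k\<close>, and its field of
  fractions as a subfield of \<open>'k\<close>. (Up to isomorphism this covers every integral domain, since one
  may take the ambient field to be the field of fractions.) In this way \<open>D\<close>, \<open>D[X]\<close> and
  \<open>Na(D,v)\<close> are all instances of the same notion: \<open>D\<close> lives in \<open>'k\<close>, the other two live in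
  \<open>'k(X)\<close>, i.e. in the type \<open>'k poly fract\<close>.
\<close>

definition is_domain :: "'k::field set \<Rightarrow> bool" where
  "is_domain R \<longleftrightarrow> 1 \<in> R \<and> (\<forall>x\<in>R. \<forall>y\<in>R. x - y \<in> R \<and> x * y \<in> R)"

definition quot_field :: "'k::field set \<Rightarrow> 'k set" where
  "quot_field R = {a / b | a b. a \<in> R \<and> b \<in> R \<and> b \<noteq> 0}"

definition submod :: "'k::field set \<Rightarrow> 'k set \<Rightarrow> bool" where
  "submod R I \<longleftrightarrow> 0 \<in> I \<and> (\<forall>x\<in>I. \<forall>y\<in>I. x + y \<in> I) \<and> (\<forall>r\<in>R. \<forall>x\<in>I. r * x \<in> I)"

text \<open>\<open>submod R hull S\<close> is the \<open>R\<close>-submodule generated by \<open>S\<close>.\<close>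

definition frac_ideal :: "'k::field set \<Rightarrow> 'k set \<Rightarrow> bool" where
  "frac_ideal R I \<longleftrightarrow>
     submod R I \<and> I \<subseteq> quot_field R \<and> (\<exists>d\<in>R. d \<noteq> 0 \<and> (\<forall>x\<in>I. d * x \<in> R))"

definition nz_ideals :: "'k::field set \<Rightarrow> 'k set set" where
  "nz_ideals R = {I. frac_ideal R I \<and> I \<noteq> {0}}"

definition fin_gen :: "'k::field set \<Rightarrow> 'k set \<Rightarrow> bool" where
  "fin_gen R I \<longleftrightarrow> (\<exists>S. finite S \<and> I = submod R hull S)"

definition ideal_prod :: "'k::field set \<Rightarrow> 'k set \<Rightarrow> 'k set \<Rightarrow> 'k set" where
  "ideal_prod R I J = submod R hull {x * y | x y. x \<in> I \<and> y \<in> J}"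

text \<open>\<open>colon R J I\<close> is \<open>(J : I)\<close>, computed in the field of fractions of \<open>R\<close>.\<close>

definition colon :: "'k::field set \<Rightarrow> 'k set \<Rightarrow> 'k set \<Rightarrow> 'k set" where
  "colon R J I = {x \<in> quot_field R. \<forall>y\<in>I. x * y \<in> J}"

definition v_op :: "'k::field set \<Rightarrow> 'k set \<Rightarrow> 'k set" where
  "v_op R I = colon R R (colon R R I)"

definition t_op :: "'k::field set \<Rightarrow> 'k set \<Rightarrow> 'k set" where
  "t_op R I = \<Union>{v_op R J | J. J \<in> nz_ideals R \<and> fin_gen R J \<and> J \<subseteq> I}"

definition proper_t_ideal :: "'k::field set \<Rightarrow> 'k set \<Rightarrow> bool" where
  "proper_t_ideal R I \<longleftrightarrow> I \<in> nz_ideals R \<and> t_op R I = I \<and> I \<subseteq> R \<and> I \<noteq> R"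

definition t_Max :: "'k::field set \<Rightarrow> 'k set set" where
  "t_Max R = {M. proper_t_ideal R M \<and> (\<forall>N. proper_t_ideal R N \<and> M \<subseteq> N \<longrightarrow> N = M)}"

definition localization :: "'k::field set \<Rightarrow> 'k set \<Rightarrow> 'k set" where
  "localization R S = {a / s | a s. a \<in> R \<and> s \<in> S}"

text \<open>
  The intersection is taken inside the field of fractions; this matters only when \<open>t_Max R\<close> is
  empty, i.e. when \<open>R\<close> is a field.
\<close>

definition w_op :: "'k::field set \<Rightarrow> 'k set \<Rightarrow> 'k set" where
  "w_op R I = {x \<in> quot_field R. \<forall>M\<in>t_Max R. x \<in> submod (localization R (R - M)) hull I}"

definition endo :: "'k::field set \<Rightarrow> 'k set \<Rightarrow> 'k set" where
  "endo R I = colon R I I"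

definition stable_ideal :: "'k::field set \<Rightarrow> 'k set \<Rightarrow> bool" where
  "stable_ideal R I \<longleftrightarrow> ideal_prod R I (colon R (endo R I) I) = endo R I"

definition w_stable :: "'k::field set \<Rightarrow> 'k set \<Rightarrow> bool" where
  "w_stable R I \<longleftrightarrow>
     (let E = endo R (w_op R I)
      in w_op R (ideal_prod R (w_op R I) (colon R E (w_op R I))) = E)"

definition w_stable_domain :: "'k::field set \<Rightarrow> bool" where
  "w_stable_domain R \<longleftrightarrow> (\<forall>I\<in>nz_ideals R. w_stable R I)"

definition vN_regular :: "'k::field set \<Rightarrow> 'k set \<Rightarrow> bool" where
  "vN_regular R I \<longleftrightarrow> (\<exists>J\<in>nz_ideals R. I = ideal_prod R (ideal_prod R I I) J)"

definition w_regular :: "'k::field set \<Rightarrow> 'k set \<Rightarrow> bool" where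
  "w_regular R I \<longleftrightarrow>
     (\<exists>J\<in>nz_ideals R. w_op R I = w_op R (ideal_prod R (ideal_prod R I I) J))"

definition Clifford_w_regular :: "'k::field set \<Rightarrow> bool" where
  "Clifford_w_regular R \<longleftrightarrow> (\<forall>I\<in>nz_ideals R. w_regular R I)"

definition polys_over :: "'k::field set \<Rightarrow> 'k poly set" where
  "polys_over D = {h. \<forall>i. coeff h i \<in> D}"

definition poly_ring :: "'k::field set \<Rightarrow> 'k poly fract set" where
  "poly_ring D = to_fract ` polys_over D"

definition content_ideal :: "'k::field set \<Rightarrow> 'k poly \<Rightarrow> 'k set" where
  "content_ideal D h = submod D hull range (coeff h)"

definition N_v :: "'k::field set \<Rightarrow> 'k poly set" where
  "N_v D = {h \<in> polys_over D. h \<noteq> 0 \<and> v_op D (content_ideal D h) = D}"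

definition Na_v :: "'k::field set \<Rightarrow> 'k poly fract set" where
  "Na_v D = localization (poly_ring D) (to_fract ` N_v D)"

text \<open>
  The ideals \<open>I T\<close> of a subring \<open>T\<close> of \<open>'k(X)\<close> containing \<open>D\<close>, for \<open>I\<close> a fractional ideal
  of \<open>D\<close>; the elements of \<open>I\<close> are regarded as constants in \<open>'k(X)\<close>.
\<close>

definition extended_ideals :: "'k::field set \<Rightarrow> 'k poly fract set \<Rightarrow> 'k poly fract set set" where
  "extended_ideals D T = {submod T hull ((\<lambda>a. to_fract [:a:]) ` I) | I. frac_ideal D I}"

end

theory Submission
  imports Defs
begin

text \<open>
  Call a finite \<open>S \<subseteq> R\<close> a GV-set (\<open>gv_set\<close>) if the ideal \<open>J\<close> it generates satisfies \<open>(R : J) = R\<close>. Then \<open>x\<close> lies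
  in \<open>I\<^sup>w\<close> iff \<open>x S \<subseteq> I\<close> for some GV-set \<open>S\<close>, because an integral ideal contained in no
  \<open>t\<close>-maximal ideal contains a GV-set. A GV-set of \<open>D\<close> remains one in \<open>D[X]\<close>, and in \<open>Na(D,v)\<close> it
  generates the unit ideal, being the set of coefficients of a unit. So \<open>I\<^sup>w\<close> is contained in
  \<open>(I D[X])\<^sup>w\<close> and in \<open>I Na(D,v)\<close>, and both the equation \<open>I\<^sup>w = (I\<^sup>2 J)\<^sup>w\<close> and the relation
  \<open>1 \<in> (I\<^sup>w (E : I\<^sup>w))\<^sup>w\<close> carry over to the extended ideals. That \<open>Na(D,v)\<close> is a ring follows from the
  primality of \<open>t\<close>-maximal ideals by a Gauss lemma argument.
\<close>

section \<open>Submodules and fractional ideals\<close>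

lemma submodI:
  assumes "0 \<in> I" "\<And>x y. x \<in> I \<Longrightarrow> y \<in> I \<Longrightarrow> x + y \<in> I" "\<And>r x. r \<in> R \<Longrightarrow> x \<in> I \<Longrightarrow> r * x \<in> I"
  shows "submod R I"
  using assms by (simp add: submod_def)

lemma submodD:
  assumes "submod R I"
  shows submod_0: "0 \<in> I"
    and submod_add: "x \<in> I \<Longrightarrow> y \<in> I \<Longrightarrow> x + y \<in> I"
    and submod_mult: "r \<in> R \<Longrightarrow> x \<in> I \<Longrightarrow> r * x \<in> I"
  using assms by (auto simp: submod_def)

lemma submod_mult_right: "submod R I \<Longrightarrow> r \<in> R \<Longrightarrow> x \<in> I \<Longrightarrow> x * r \<in> I"
  by (metis submod_mult mult.commute)

lemma submod_sum: "submod R I \<Longrightarrow> (\<And>x. x \<in> A \<Longrightarrow> f x \<in> I) \<Longrightarrow> sum f A \<in> I"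
  by (induction A rule: infinite_finite_induct) (auto intro: submod_0 submod_add)

lemma submod_submod_hull: "submod R (submod R hull S)"
  by (rule hull_in) (auto simp: submod_def)

lemma submod_hull_le: "submod R M \<Longrightarrow> S \<subseteq> M \<Longrightarrow> submod R hull S \<subseteq> M"
  by (rule hull_minimal)

text \<open>Minimality of the hull is applied to such residuals: a membership about products then
  has to be checked for generators only.\<close>

lemma submod_residual: "submod R M \<Longrightarrow> submod R {x. \<forall>b\<in>B. x * b \<in> M}"
  by (auto simp: submod_def distrib_right mult.assoc)

text \<open>The residual argument is used twice: first \<open>x\<close> varies while the right
  factor is a generator, then \<open>y\<close> varies while \<open>x\<close> is fixed. The scalar
  \<open>z\<close> may be any field element; later it is \<open>1\<close> or a constant
  \<open>const x\<close> with \<open>x\<close> in a colon ideal.\<close>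

lemma hull_mult_mem:
  assumes M: "submod R M" and gen: "\<And>a b. a \<in> A \<Longrightarrow> b \<in> B \<Longrightarrow> z * a * b \<in> M"
    and x: "x \<in> submod R hull A" and y: "y \<in> submod R hull B"
  shows "z * x * y \<in> M"
proof -
  have 1: "submod R {x. \<forall>b\<in>(\<lambda>b. z * b) ` B. x * b \<in> M}"
    by (rule submod_residual[OF M])
  have "submod R hull A \<subseteq> {x. \<forall>b\<in>(\<lambda>b. z * b) ` B. x * b \<in> M}"
    by (rule submod_hull_le[OF 1]) (use gen in \<open>auto simp: ac_simps\<close>)
  then have xb: "b \<in> B \<Longrightarrow> b * (z * x) \<in> M" for b
    using x by (auto simp: ac_simps)
  have "submod R hull B \<subseteq> {y. \<forall>b\<in>{z * x}. y * b \<in> M}"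
    by (rule submod_hull_le[OF submod_residual[OF M]]) (use xb in auto)
  then show ?thesis
    using y by (auto simp: ac_simps)
qed

lemma submod_ideal_prod: "submod R (ideal_prod R I J)"
  unfolding ideal_prod_def by (rule submod_submod_hull)

lemma ideal_prod_memI: "x \<in> I \<Longrightarrow> y \<in> J \<Longrightarrow> x * y \<in> ideal_prod R I J"
  unfolding ideal_prod_def by (rule hull_inc) blast

lemma ideal_prod_le:
  "submod R M \<Longrightarrow> (\<And>x y. x \<in> I \<Longrightarrow> y \<in> J \<Longrightarrow> x * y \<in> M) \<Longrightarrow> ideal_prod R I J \<subseteq> M"
  unfolding ideal_prod_def by (rule submod_hull_le) auto

lemma quot_field_memI: "a \<in> R \<Longrightarrow> b \<in> R \<Longrightarrow> b \<noteq> 0 \<Longrightarrow> a / b \<in> quot_field R"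
  by (auto simp: quot_field_def)

lemma quot_fieldE:
  assumes "x \<in> quot_field R"
  obtains a b where "x = a / b" "a \<in> R" "b \<in> R" "b \<noteq> 0"
  using assms by (auto simp: quot_field_def)

lemma nz_ideals_iff:
  "I \<in> nz_ideals R \<longleftrightarrow> submod R I \<and> I \<subseteq> quot_field R \<and> (\<exists>d\<in>R. d \<noteq> 0 \<and> (\<forall>x\<in>I. d * x \<in> R))
    \<and> (\<exists>i\<in>I. i \<noteq> 0)"
  by (auto simp: nz_ideals_def frac_ideal_def submod_def)

lemma nz_idealsD:
  assumes "I \<in> nz_ideals R"
  shows nz_ideals_submod: "submod R I" and nz_ideals_quot: "x \<in> I \<Longrightarrow> x \<in> quot_field R"
  using assms by (auto simp: nz_ideals_iff)

lemma nz_ideals_denom: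
  assumes "I \<in> nz_ideals R"
  obtains d where "d \<in> R" "d \<noteq> 0" "\<And>x. x \<in> I \<Longrightarrow> d * x \<in> R"
  using assms by (auto simp: nz_ideals_iff)

lemma nz_ideals_nonzero:
  assumes "I \<in> nz_ideals R"
  obtains i where "i \<in> I" "i \<noteq> 0"
  using assms by (auto simp: nz_ideals_iff)

text \<open>Elementwise form of \<open>(R : J) = R\<close> for the ideal \<open>J\<close> generated
  by \<open>S\<close>; the inclusion of \<open>R\<close> in \<open>(R : J)\<close> is automatic
  since \<open>S\<close> lies in \<open>R\<close>. With finite sets instead of ideals, GV-sets can
  be multiplied and mapped to other rings without computing hulls.\<close>

definition gv_set :: "'k::field set \<Rightarrow> 'k set \<Rightarrow> bool" where
  "gv_set R S \<longleftrightarrow> finite S \<and> S \<subseteq> R \<and> (\<forall>x\<in>quot_field R. (\<forall>s\<in>S. x * s \<in> R) \<longrightarrow> x \<in> R)"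

lemma gv_setD: "gv_set R S \<Longrightarrow> x \<in> quot_field R \<Longrightarrow> (\<And>s. s \<in> S \<Longrightarrow> x * s \<in> R) \<Longrightarrow> x \<in> R"
  by (auto simp: gv_set_def)

lemma gv_set_mem: "gv_set R S \<Longrightarrow> s \<in> S \<Longrightarrow> s \<in> R"
  by (auto simp: gv_set_def)

lemma colon_hull: "submod R J \<Longrightarrow> colon R J (submod R hull S) = colon R J S"
proof (intro subset_antisym subsetI)
  fix x assume "x \<in> colon R J (submod R hull S)"
  then show "x \<in> colon R J S"
    by (auto simp: colon_def hull_inc)
next
  fix x assume J: "submod R J" and x: "x \<in> colon R J S"
  have "submod R hull S \<subseteq> {y. \<forall>b\<in>{x}. y * b \<in> J}"
    by (rule submod_hull_le[OF submod_residual[OF J]]) (use x in \<open>auto simp: colon_def ac_simps\<close>)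
  then show "x \<in> colon R J (submod R hull S)"
    using x by (auto simp: colon_def ac_simps)
qed

section \<open>Arithmetic of fractional ideals over a fixed domain\<close>

locale domain_in_field =
  fixes R :: "'k::field set"
  assumes dom: "is_domain R"
begin

lemma one_mem: "1 \<in> R"
  using dom by (simp add: is_domain_def)

lemma diff_mem: "x \<in> R \<Longrightarrow> y \<in> R \<Longrightarrow> x - y \<in> R"
  and mult_mem: "x \<in> R \<Longrightarrow> y \<in> R \<Longrightarrow> x * y \<in> R"
  using dom by (auto simp: is_domain_def)

lemma zero_mem: "0 \<in> R"
  using diff_mem[OF one_mem one_mem] by simp

lemma uminus_mem: "x \<in> R \<Longrightarrow> - x \<in> R"
  using diff_mem[OF zero_mem] by simp

lemma add_mem: "x \<in> R \<Longrightarrow> y \<in> R \<Longrightarrow> x + y \<in> R"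
  using diff_mem[OF _ uminus_mem] by fastforce

lemma submod_self: "submod R R"
  by (rule submodI) (auto intro: zero_mem add_mem mult_mem)

lemma quot_of_mem: "x \<in> R \<Longrightarrow> x \<in> quot_field R"
  using quot_field_memI[of x R 1] one_mem by simp

lemma quot_mult: "x \<in> quot_field R \<Longrightarrow> y \<in> quot_field R \<Longrightarrow> x * y \<in> quot_field R"
  by (elim quot_fieldE) (auto intro!: quot_field_memI mult_mem)

lemma quot_inverse: "x \<in> quot_field R \<Longrightarrow> inverse x \<in> quot_field R"
  by (cases "x = 0"; elim quot_fieldE) (auto intro: quot_field_memI quot_of_mem simp: zero_mem)

lemma quot_add: "x \<in> quot_field R \<Longrightarrow> y \<in> quot_field R \<Longrightarrow> x + y \<in> quot_field R"
  by (elim quot_fieldE) (auto simp: add_frac_eq intro!: quot_field_memI mult_mem add_mem)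

lemma submod_quot: "submod R (quot_field R)"
  by (rule submodI) (auto intro: quot_add quot_mult quot_of_mem zero_mem)

text \<open>The numerator \<open>a\<close> of a nonzero element \<open>a / b\<close> of
  \<open>I\<close> is \<open>b * (a / b)\<close>, hence again in \<open>I\<close>.\<close>

lemma nz_ideals_numerator:
  assumes "I \<in> nz_ideals R"
  obtains i where "i \<in> I" "i \<in> R" "i \<noteq> 0"
proof -
  obtain i where i: "i \<in> I" "i \<noteq> 0"
    by (rule nz_ideals_nonzero[OF assms])
  then obtain a b where "i = a / b" "a \<in> R" "b \<in> R" "b \<noteq> 0"
    using nz_ideals_quot[OF assms] quot_fieldE by metis
  moreover from this have "b * i \<in> I"
    using i submod_mult[OF nz_ideals_submod[OF assms]] by blast
  ultimately show thesis
    using i by (intro that[of a]) auto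
qed

lemma nz_ideals_integralI:
  "submod R I \<Longrightarrow> I \<subseteq> R \<Longrightarrow> i \<in> I \<Longrightarrow> i \<noteq> 0 \<Longrightarrow> I \<in> nz_ideals R"
  unfolding nz_ideals_iff using one_mem quot_of_mem
  by (intro conjI bexI[of _ 1] bexI[of _ i]) auto

lemma ideal_prod_nz_ideals:
  assumes I: "I \<in> nz_ideals R" and J: "J \<in> nz_ideals R"
  shows "ideal_prod R I J \<in> nz_ideals R"
proof -
  obtain i j where ij: "i \<in> I" "i \<noteq> 0" "j \<in> J" "j \<noteq> 0"
    by (metis nz_ideals_nonzero I J)
  obtain d where d: "d \<in> R" "d \<noteq> 0" "\<And>x. x \<in> I \<Longrightarrow> d * x \<in> R"
    using nz_ideals_denom[OF I] by metis
  obtain e where e: "e \<in> R" "e \<noteq> 0" "\<And>x. x \<in> J \<Longrightarrow> e * x \<in> R"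
    using nz_ideals_denom[OF J] by metis
  have "ideal_prod R I J \<subseteq> {x. \<forall>b\<in>{d * e}. x * b \<in> R}"
  proof (rule ideal_prod_le[OF submod_residual[OF submod_self]])
    fix x y assume "x \<in> I" "y \<in> J"
    then show "x * y \<in> {x. \<forall>b\<in>{d * e}. x * b \<in> R}"
      using mult_mem[OF d(3) e(3), of x y] by (simp add: ac_simps)
  qed
  then have "\<forall>x\<in>ideal_prod R I J. (d * e) * x \<in> R"
    by (auto simp: ac_simps)
  moreover have "ideal_prod R I J \<subseteq> quot_field R"
    by (rule ideal_prod_le[OF submod_quot]) (auto intro: quot_mult nz_ideals_quot I J)
  moreover have "i * j \<in> ideal_prod R I J"
    using ij by (intro ideal_prod_memI)
  ultimately show ?thesis
    unfolding nz_ideals_iff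
    using ij d e by (intro conjI bexI[of _ "d * e"] bexI[of _ "i * j"])
      (auto intro: mult_mem submod_ideal_prod)
qed

lemma submod_colon: "submod R J \<Longrightarrow> submod R (colon R J I)"
  by (rule submodI)
    (auto simp: colon_def distrib_right mult.assoc zero_mem
      intro: quot_of_mem quot_add quot_mult submod_0 submod_add submod_mult)

text \<open>If \<open>d\<close> and \<open>e\<close> are denominators of \<open>I\<close> and
  \<open>J\<close>, then \<open>j * d\<close> is a nonzero element of the colon for nonzero
  \<open>j\<close> in \<open>J\<close>, and \<open>e * i\<close> is a denominator of it for nonzero
  \<open>i\<close> in \<open>I\<close>. Here \<open>i\<close> is taken in \<open>R\<close> so that
  \<open>e * i\<close> lies in \<open>R\<close>.\<close>

lemma colon_nz_ideals:
  assumes I: "I \<in> nz_ideals R" and J: "J \<in> nz_ideals R"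
  shows "colon R J I \<in> nz_ideals R"
proof -
  obtain j where j: "j \<in> J" "j \<noteq> 0"
    by (rule nz_ideals_nonzero[OF J])
  obtain i where i: "i \<in> I" "i \<in> R" "i \<noteq> 0"
    by (rule nz_ideals_numerator[OF I])
  obtain d where d: "d \<in> R" "d \<noteq> 0" "\<And>x. x \<in> I \<Longrightarrow> d * x \<in> R"
    using nz_ideals_denom[OF I] by metis
  obtain e where e: "e \<in> R" "e \<noteq> 0" "\<And>x. x \<in> J \<Longrightarrow> e * x \<in> R"
    using nz_ideals_denom[OF J] by metis
  have "j * d \<in> colon R J I"
    using submod_mult_right[OF nz_ideals_submod[OF J] d(3) j(1)] quot_mult[of j d]
      quot_of_mem[OF d(1)] nz_ideals_quot[OF J j(1)]
    by (simp add: colon_def mult.assoc)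
  moreover have "(e * i) * x \<in> R" if "x \<in> colon R J I" for x
    using that e(3)[of "x * i"] i by (auto simp: colon_def ac_simps)
  ultimately show ?thesis
    unfolding nz_ideals_iff using j d e i submod_colon[OF nz_ideals_submod[OF J]]
    by (intro conjI bexI[of _ "e * i"] bexI[of _ "j * d"])
      (auto intro: mult_mem simp: colon_def)
qed

lemma one_mem_endo: "1 \<in> endo R I"
  by (auto simp: endo_def colon_def intro: quot_of_mem one_mem)

lemma ideal_prod_colon_endo_le:
  assumes "submod R I"
  shows "ideal_prod R I (colon R (endo R I) I) \<subseteq> endo R I"
  unfolding endo_def
  by (rule ideal_prod_le[OF submod_colon[OF assms]]) (auto simp: colon_def mult.commute)

text \<open>The factor \<open>e\<close> is absorbed by the left factor because \<open>e I\<close> is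
  contained in \<open>I\<close>. So the product is an ideal of \<open>endo R I\<close>, and
  comparing it with \<open>endo R I\<close> becomes a question about the element 1.\<close>

lemma ideal_prod_colon_endo_closed:
  assumes I: "submod R I" and e: "e \<in> endo R I" and x: "x \<in> ideal_prod R I (colon R (endo R I) I)"
  shows "e * x \<in> ideal_prod R I (colon R (endo R I) I)" (is "_ \<in> ?P")
proof -
  have "?P \<subseteq> {x. \<forall>b\<in>{e}. x * b \<in> ?P}"
  proof (rule ideal_prod_le[OF submod_residual[OF submod_ideal_prod]])
    fix a b assume "a \<in> I" "b \<in> colon R (endo R I) I"
    then have "(e * a) * b \<in> ?P"
      using e by (intro ideal_prod_memI) (auto simp: endo_def colon_def)
    then show "a * b \<in> {x. \<forall>b\<in>{e}. x * b \<in> ?P}"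
      by (simp add: ac_simps)
  qed
  then show ?thesis
    using x by (auto simp: ac_simps)
qed

section \<open>The \<open>t\<close>-operation and \<open>t\<close>-maximal ideals\<close>

lemma v_op_hull: "v_op R (submod R hull S) = v_op R S"
  unfolding v_op_def by (simp add: colon_hull submod_self)

lemma v_op_memD:
  "x \<in> v_op R S \<Longrightarrow> y \<in> quot_field R \<Longrightarrow> (\<And>s. s \<in> S \<Longrightarrow> y * s \<in> R) \<Longrightarrow> x * y \<in> R"
  by (auto simp: v_op_def colon_def)

lemma v_op_mono: "S \<subseteq> S' \<Longrightarrow> v_op R S \<subseteq> v_op R S'"
  by (auto simp: v_op_def colon_def)

lemma v_op_extensive: "S \<subseteq> quot_field R \<Longrightarrow> S \<subseteq> v_op R S"
  by (auto simp: v_op_def colon_def mult.commute)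

lemma v_op_minimal: "S \<subseteq> v_op R S' \<Longrightarrow> v_op R S \<subseteq> v_op R S'"
proof
  fix x assume le: "S \<subseteq> v_op R S'" and x: "x \<in> v_op R S"
  have "x * y \<in> R" if y: "y \<in> colon R R S'" for y
  proof (rule v_op_memD[OF x])
    show "y \<in> quot_field R"
      using y by (simp add: colon_def)
    fix s assume "s \<in> S"
    then have "s \<in> v_op R S'" using le by blast
    then show "y * s \<in> R"
      using y by (auto simp: v_op_def colon_def mult.commute)
  qed
  with x show "x \<in> v_op R S'"
    by (simp add: v_op_def colon_def)
qed

lemma submod_v_op: "submod R (v_op R S)"
  unfolding v_op_def by (rule submod_colon[OF submod_self])

lemma v_op_integral: "S \<subseteq> R \<Longrightarrow> v_op R S \<subseteq> R"
  using v_op_memD[of _ S 1] one_mem quot_of_mem by auto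

lemma v_op_eq_iff: "S \<subseteq> R \<Longrightarrow> v_op R S = R \<longleftrightarrow> 1 \<in> v_op R S"
proof
  assume S: "S \<subseteq> R" and "1 \<in> v_op R S"
  then have "r \<in> v_op R S" if "r \<in> R" for r
    using submod_mult_right[OF submod_v_op that, of 1] by simp
  with v_op_integral[OF S] show "v_op R S = R" by blast
qed (use one_mem in auto)

text \<open>That 1 lies in \<open>v_op R S\<close> means that every \<open>x\<close> in
  \<open>(R : S)\<close> satisfies \<open>1 * x \<in> R\<close>, which is the GV condition. This
  links GV-sets to the t-operation.\<close>

lemma gv_set_iff: "gv_set R S \<longleftrightarrow> finite S \<and> S \<subseteq> R \<and> 1 \<in> v_op R S"
  using quot_of_mem[OF one_mem] by (auto simp: gv_set_def v_op_def colon_def)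

text \<open>Finite sets replace nonzero finitely generated ideals. If \<open>S\<close> is empty or
  \<open>{0}\<close>, it generates no nonzero ideal, so a nonzero \<open>i\<close> from
  \<open>I\<close> is adjoined; this can only enlarge the v-closure.\<close>

lemma t_op_iff:
  assumes I: "I \<in> nz_ideals R"
  shows "x \<in> t_op R I \<longleftrightarrow> (\<exists>S. finite S \<and> S \<subseteq> I \<and> x \<in> v_op R S)"
proof
  assume "x \<in> t_op R I"
  then obtain J where "x \<in> v_op R J" "J \<subseteq> I" "fin_gen R J"
    by (auto simp: t_op_def)
  then obtain S where "finite S" "J = submod R hull S"
    by (auto simp: fin_gen_def)
  then show "\<exists>S. finite S \<and> S \<subseteq> I \<and> x \<in> v_op R S"
    using \<open>x \<in> v_op R J\<close> \<open>J \<subseteq> I\<close> v_op_hull hull_inc[of _ S "submod R"] by blast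
next
  assume "\<exists>S. finite S \<and> S \<subseteq> I \<and> x \<in> v_op R S"
  then obtain S where S: "finite S" "S \<subseteq> I" "x \<in> v_op R S" by blast
  obtain i where i: "i \<in> I" "i \<noteq> 0"
    by (rule nz_ideals_nonzero[OF I])
  let ?J = "submod R hull (insert i S)"
  have le: "?J \<subseteq> I"
    by (rule submod_hull_le) (use S i nz_ideals_submod[OF I] in auto)
  have "i \<in> ?J"
    by (rule hull_inc) simp
  then have "?J \<in> nz_ideals R"
    using le I i submod_submod_hull[of R "insert i S"] by (auto simp: nz_ideals_iff subset_iff)
  moreover have "fin_gen R ?J"
    unfolding fin_gen_def using S by blast
  moreover have "x \<in> v_op R ?J"
    using S(3) v_op_mono[of S "insert i S"] by (auto simp: v_op_hull)
  ultimately show "x \<in> t_op R I"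
    using le by (auto simp: t_op_def)
qed

lemma t_op_integral: "I \<in> nz_ideals R \<Longrightarrow> I \<subseteq> R \<Longrightarrow> t_op R I \<subseteq> R"
proof
  fix x assume I: "I \<in> nz_ideals R" "I \<subseteq> R" and "x \<in> t_op R I"
  then obtain S where "S \<subseteq> I" "x \<in> v_op R S"
    using t_op_iff[OF I(1)] by blast
  then show "x \<in> R"
    using v_op_integral[of S] I(2) by blast
qed

lemma t_op_extensive: "I \<in> nz_ideals R \<Longrightarrow> I \<subseteq> t_op R I"
proof
  fix x assume I: "I \<in> nz_ideals R" and x: "x \<in> I"
  then have "x \<in> v_op R {x}"
    using v_op_extensive[of "{x}"] nz_ideals_quot by auto
  then show "x \<in> t_op R I"
    unfolding t_op_iff[OF I] using x by (intro exI[of _ "{x}"]) auto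
qed

lemma submod_t_op:
  assumes I: "I \<in> nz_ideals R"
  shows "submod R (t_op R I)"
proof (rule submodI)
  show "0 \<in> t_op R I"
    using t_op_extensive[OF I] submod_0[OF nz_ideals_submod[OF I]] by auto
next
  fix x y assume "x \<in> t_op R I" "y \<in> t_op R I"
  then obtain S S' where "finite S" "S \<subseteq> I" "x \<in> v_op R S" "finite S'" "S' \<subseteq> I" "y \<in> v_op R S'"
    unfolding t_op_iff[OF I] by blast
  then show "x + y \<in> t_op R I"
    unfolding t_op_iff[OF I]
    using v_op_mono[of S "S \<union> S'"] v_op_mono[of S' "S \<union> S'"]
    by (intro exI[of _ "S \<union> S'"]) (auto intro!: submod_add[OF submod_v_op])
next
  fix r x assume "r \<in> R" "x \<in> t_op R I"
  then show "r * x \<in> t_op R I"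
    unfolding t_op_iff[OF I] using submod_mult[OF submod_v_op] by blast
qed

lemma t_op_nz_ideals:
  assumes "I \<in> nz_ideals R" "I \<subseteq> R"
  shows "t_op R I \<in> nz_ideals R"
proof -
  obtain i where "i \<in> I" "i \<noteq> 0"
    by (rule nz_ideals_nonzero[OF assms(1)])
  then show ?thesis
    using t_op_extensive[OF assms(1)]
    by (intro nz_ideals_integralI[of _ i] submod_t_op t_op_integral assms) auto
qed

text \<open>Finite character: a finite \<open>S\<close> in the t-closure needs one finite subset
  \<open>F s\<close> of \<open>I\<close> for each \<open>s\<close>, and the union of these is still
  a finite subset of \<open>I\<close>.\<close>

lemma t_op_idem:
  assumes I: "I \<in> nz_ideals R" "I \<subseteq> R"
  shows "t_op R (t_op R I) = t_op R I"
proof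
  note I' = t_op_nz_ideals[OF I]
  show "t_op R (t_op R I) \<subseteq> t_op R I"
  proof
    fix x assume "x \<in> t_op R (t_op R I)"
    then obtain S where S: "finite S" "S \<subseteq> t_op R I" "x \<in> v_op R S"
      unfolding t_op_iff[OF I'] by blast
    then have "\<forall>s\<in>S. \<exists>F. finite F \<and> F \<subseteq> I \<and> s \<in> v_op R F"
      using t_op_iff[OF I(1)] by blast
    then obtain F where F: "\<And>s. s \<in> S \<Longrightarrow> finite (F s) \<and> F s \<subseteq> I \<and> s \<in> v_op R (F s)"
      by metis
    have "S \<subseteq> v_op R (\<Union>s\<in>S. F s)"
      using F v_op_mono[of "F _" "\<Union>s\<in>S. F s"] by blast
    then have "x \<in> v_op R (\<Union>s\<in>S. F s)"
      using v_op_minimal S by blast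
    then show "x \<in> t_op R I"
      unfolding t_op_iff[OF I(1)] using S F by (intro exI[of _ "\<Union>s\<in>S. F s"]) auto
  qed
  show "t_op R I \<subseteq> t_op R (t_op R I)"
    by (rule t_op_extensive[OF I'])
qed

text \<open>The form suited to unions of chains: properness concerns the single element 1, and being
  a t-ideal concerns finite subsets only.\<close>

lemma proper_t_ideal_iff:
  "proper_t_ideal R I \<longleftrightarrow> I \<in> nz_ideals R \<and> I \<subseteq> R \<and> 1 \<notin> I \<and>
    (\<forall>S. finite S \<longrightarrow> S \<subseteq> I \<longrightarrow> v_op R S \<subseteq> I)"
proof -
  have "t_op R I = I \<longleftrightarrow> (\<forall>S. finite S \<longrightarrow> S \<subseteq> I \<longrightarrow> v_op R S \<subseteq> I)" if I: "I \<in> nz_ideals R"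
  proof -
    have "t_op R I = (\<Union>S\<in>{S. finite S \<and> S \<subseteq> I}. v_op R S)"
      using t_op_iff[OF I] by auto
    then have "t_op R I \<subseteq> I \<longleftrightarrow> (\<forall>S. finite S \<longrightarrow> S \<subseteq> I \<longrightarrow> v_op R S \<subseteq> I)"
      by (simp add: UN_subset_iff imp_conjL)
    then show ?thesis
      using t_op_extensive[OF I] unfolding set_eq_subset by (simp only: simp_thms)
  qed
  moreover have "I = R \<longleftrightarrow> 1 \<in> I" if I: "I \<in> nz_ideals R" "I \<subseteq> R"
  proof
    assume "1 \<in> I"
    then have "r \<in> I" if "r \<in> R" for r
      using submod_mult[OF nz_ideals_submod[OF I(1)] that, of 1] by simp
    with I(2) show "I = R" by blast
  qed (use one_mem in auto)
  ultimately show ?thesis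
    unfolding proper_t_ideal_def by (cases "I \<in> nz_ideals R"; cases "I \<subseteq> R") (simp_all add: conj_ac)
qed

lemma proper_t_ideal_t_op:
  assumes "I \<in> nz_ideals R" "I \<subseteq> R" "1 \<notin> t_op R I"
  shows "proper_t_ideal R (t_op R I)"
  unfolding proper_t_ideal_def
  using t_op_nz_ideals[OF assms(1,2)] t_op_idem[OF assms(1,2)] t_op_integral[OF assms(1,2)]
    one_mem assms(3) by (intro conjI notI) simp_all

text \<open>Zorn's lemma applies because the \<open>t\<close>-operation has finite character.\<close>

lemma t_Max_above:
  assumes I: "proper_t_ideal R I"
  obtains M where "M \<in> t_Max R" "I \<subseteq> M"
proof -
  let ?A = "{N. proper_t_ideal R N \<and> I \<subseteq> N}"
  have "\<exists>M\<in>?A. \<forall>X\<in>?A. M \<subseteq> X \<longrightarrow> X = M"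
  proof (rule subset_Zorn_nonempty)
    show "?A \<noteq> {}" using I by auto
  next
    fix C assume ne: "C \<noteq> {}" and ch: "subset.chain ?A C"
    then have C: "\<And>N. N \<in> C \<Longrightarrow> proper_t_ideal R N" "\<And>N. N \<in> C \<Longrightarrow> I \<subseteq> N"
      by (auto simp: subset.chain_def)
    have fin: "\<exists>N\<in>C. S \<subseteq> N" if "finite S" "S \<subseteq> \<Union>C" for S
      by (metis finite_subset_Union_chain[OF that ne ch])
    have sub: "submod R N" if "N \<in> C" for N
      using C(1)[OF that] by (auto simp: proper_t_ideal_iff nz_ideals_submod)
    have le: "\<Union>C \<subseteq> R"
      using C(1) by (auto simp: proper_t_ideal_iff)
    have "submod R (\<Union>C)"
    proof (rule submodI)
      show "0 \<in> \<Union>C" using ne sub submod_0 by blast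
    next
      fix x y assume "x \<in> \<Union>C" "y \<in> \<Union>C"
      then obtain N where "N \<in> C" "x \<in> N" "y \<in> N"
        using fin[of "{x, y}"] by auto
      then show "x + y \<in> \<Union>C"
        using submod_add[OF sub] by blast
    next
      fix r x assume "r \<in> R" "x \<in> \<Union>C"
      then show "r * x \<in> \<Union>C" using sub submod_mult by blast
    qed
    moreover have IC: "I \<subseteq> \<Union>C"
      using C(2) ne by blast
    moreover obtain i where "i \<in> I" "i \<noteq> 0"
      using I nz_ideals_nonzero by (metis proper_t_ideal_iff)
    ultimately have "\<Union>C \<in> nz_ideals R"
      using nz_ideals_integralI le by blast
    moreover have "1 \<notin> \<Union>C"
      using C(1) by (auto simp: proper_t_ideal_iff)
    moreover have "v_op R S \<subseteq> \<Union>C" if S: "finite S" "S \<subseteq> \<Union>C" for S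
    proof -
      obtain N where "N \<in> C" "S \<subseteq> N"
        using fin[OF S] by blast
      then show ?thesis
        using C(1)[of N] S(1) unfolding proper_t_ideal_iff by blast
    qed
    ultimately show "\<Union>C \<in> ?A"
      using IC le by (auto simp: proper_t_ideal_iff)
  qed
  then show thesis
    by (elim bexE) (rule that, auto simp: t_Max_def)
qed

text \<open>If 1 were missing from the t-closure of \<open>A\<close>, that closure would be a proper
  t-ideal, and a t-maximal ideal above it would contain \<open>A\<close>. So 1 is in the t-closure,
  and a finite subset of \<open>A\<close> witnessing this is a GV-set. This turns a condition at all
  t-maximal ideals into a single finite set.\<close>

lemma gv_set_if_not_in_t_Max:
  assumes A: "A \<in> nz_ideals R" "A \<subseteq> R" and M: "\<And>M. M \<in> t_Max R \<Longrightarrow> \<not> A \<subseteq> M"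
  obtains S where "gv_set R S" "S \<subseteq> A"
proof -
  have "1 \<in> t_op R A"
  proof (rule ccontr)
    assume "1 \<notin> t_op R A"
    then obtain M where "M \<in> t_Max R" "t_op R A \<subseteq> M"
      using t_Max_above[OF proper_t_ideal_t_op[OF A]] by blast
    then show False
      using M t_op_extensive[OF A(1)] by blast
  qed
  then obtain S where "finite S" "S \<subseteq> A" "1 \<in> v_op R S"
    unfolding t_op_iff[OF A(1)] by blast
  then show thesis
    using that A by (auto simp: gv_set_iff)
qed

section \<open>Primality of t-maximal ideals\<close>

lemma t_Max_D:
  assumes "M \<in> t_Max R"
  shows t_Max_submod: "submod R M" and t_Max_le: "M \<subseteq> R" and t_Max_nz: "M \<in> nz_ideals R"
    and t_Max_not_one: "1 \<notin> M"
proof -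
  have M: "proper_t_ideal R M"
    using assms by (simp add: t_Max_def)
  then show "M \<subseteq> R" "M \<in> nz_ideals R" "1 \<notin> M"
    unfolding proper_t_ideal_iff by simp_all
  then show "submod R M"
    by (simp add: nz_ideals_submod)
qed

lemma t_Max_not_gv_set:
  assumes "M \<in> t_Max R" "gv_set R S"
  shows "\<not> S \<subseteq> M"
proof
  assume "S \<subseteq> M"
  moreover have "proper_t_ideal R M"
    using assms by (simp add: t_Max_def)
  ultimately show False
    using assms(2) unfolding proper_t_ideal_iff gv_set_iff by blast
qed

text \<open>The factors are cancelled one at a time: \<open>x * s\<close> lies in \<open>R\<close>
  by the GV-set \<open>F s\<close>, then \<open>x\<close> lies in \<open>R\<close> by
  \<open>S\<close>. The second set may depend on \<open>s\<close>, as \<open>w_op_closed\<close>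
  requires; a constant family gives the product of two GV-sets.\<close>

lemma gv_set_Sigma:
  assumes S: "gv_set R S" and F: "\<And>s. s \<in> S \<Longrightarrow> gv_set R (F s)"
  shows "gv_set R {s * t | s t. s \<in> S \<and> t \<in> F s}" (is "gv_set R ?U")
proof -
  have U: "?U = (\<Union>s\<in>S. (*) s ` F s)" by blast
  have "finite ?U"
    unfolding U using S F by (auto simp: gv_set_def)
  moreover have "?U \<subseteq> R"
    using S F by (auto simp: gv_set_def intro!: mult_mem)
  moreover have "x \<in> R" if x: "x \<in> quot_field R" "\<forall>u\<in>?U. x * u \<in> R" for x
  proof (rule gv_setD[OF S x(1)])
    fix s assume s: "s \<in> S"
    show "x * s \<in> R"
    proof (rule gv_setD[OF F[OF s]])
      show "x * s \<in> quot_field R"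
        using S s by (intro quot_mult[OF x(1)] quot_of_mem) (auto simp: gv_set_def)
      fix t assume "t \<in> F s"
      then show "x * s * t \<in> R" using x(2) s unfolding mult.assoc by blast
    qed
  qed
  ultimately show ?thesis
    by (auto simp: gv_set_def)
qed

text \<open>A t-maximal ideal containing \<open>M + R a\<close> would contain \<open>M\<close>,
  hence equal \<open>M\<close>, but \<open>a\<close> is not in \<open>M\<close>. So
  \<open>M + R a\<close> contains a GV-set, which plays the role of the relation
  \<open>1 = m + r a\<close> at an ordinary maximal ideal.\<close>

lemma t_Max_add_gv_set:
  assumes M: "M \<in> t_Max R" and a: "a \<in> R" "a \<notin> M"
  obtains S where "gv_set R S" "\<And>s. s \<in> S \<Longrightarrow> \<exists>m\<in>M. \<exists>r\<in>R. s = m + r * a"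
proof -
  let ?A = "{m + r * a | m r. m \<in> M \<and> r \<in> R}"
  note M' = t_Max_submod[OF M] t_Max_le[OF M]
  have MA: "M \<subseteq> ?A"
    using zero_mem by force
  have aA: "a \<in> ?A"
    using submod_0[OF M'(1)] one_mem by force
  have "submod R ?A"
  proof (rule submodI)
    show "0 \<in> ?A" by (rule subsetD[OF MA submod_0[OF M'(1)]])
  next
    fix x y assume "x \<in> ?A" "y \<in> ?A"
    then obtain m r m' r' where "x = m + r * a" "y = m' + r' * a" "m \<in> M" "m' \<in> M" "r \<in> R" "r' \<in> R"
      by blast
    then show "x + y \<in> ?A"
      using submod_add[OF M'(1)] add_mem
      by (intro CollectI exI[of _ "m + m'"] exI[of _ "r + r'"]) (auto simp: algebra_simps)
  next
    fix q x assume "q \<in> R" "x \<in> ?A"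
    then obtain m r where "x = m + r * a" "m \<in> M" "r \<in> R" by blast
    moreover from this have "q * m \<in> M" "q * r \<in> R"
      using submod_mult[OF M'(1)] mult_mem \<open>q \<in> R\<close> by simp_all
    ultimately show "q * x \<in> ?A"
      by (intro CollectI exI[of _ "q * m"] exI[of _ "q * r"])
        (simp add: distrib_left mult.assoc)
  qed
  moreover have "?A \<subseteq> R"
    using M'(2) a by (auto intro!: add_mem mult_mem)
  moreover obtain i where "i \<in> M" "i \<noteq> 0"
    by (rule nz_ideals_nonzero[OF t_Max_nz[OF M]])
  ultimately have A: "?A \<in> nz_ideals R"
    using MA by (intro nz_ideals_integralI[of _ i]) (assumption | blast)+
  have "\<not> ?A \<subseteq> N" if N: "N \<in> t_Max R" for N
  proof
    assume "?A \<subseteq> N"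
    then have "M \<subseteq> N" "a \<in> N" using MA aA by auto
    then show False using M N a by (auto simp: t_Max_def)
  qed
  then obtain S where "gv_set R S" "S \<subseteq> ?A"
    using gv_set_if_not_in_t_Max[OF A \<open>?A \<subseteq> R\<close>] by blast
  then show thesis
    by (intro that[of S]) blast+
qed

text \<open>The classical argument with GV-sets in place of 1: if \<open>a * b\<close> were in
  \<open>M\<close>, all products of elements of \<open>M + R a\<close> and \<open>M + R b\<close>
  would be in \<open>M\<close>, among them a whole GV-set.\<close>

lemma t_Max_prime:
  assumes M: "M \<in> t_Max R" and a: "a \<in> R" "a \<notin> M" and b: "b \<in> R" "b \<notin> M"
  shows "a * b \<notin> M"
proof
  assume ab: "a * b \<in> M"
  note M' = t_Max_submod[OF M]
  obtain S where S: "gv_set R S" "\<And>s. s \<in> S \<Longrightarrow> \<exists>m\<in>M. \<exists>r\<in>R. s = m + r * a"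
    using t_Max_add_gv_set[OF M a] by metis
  obtain T where T: "gv_set R T" "\<And>s. s \<in> T \<Longrightarrow> \<exists>m\<in>M. \<exists>r\<in>R. s = m + r * b"
    using t_Max_add_gv_set[OF M b] by metis
  have "s * t \<in> M" if "s \<in> S" "t \<in> T" for s t
  proof -
    obtain m r m' r' where *: "s = m + r * a" "t = m' + r' * b" "m \<in> M" "m' \<in> M" "r \<in> R" "r' \<in> R"
      using S(2) T(2) \<open>s \<in> S\<close> \<open>t \<in> T\<close> by meson
    \<comment> \<open>This expansion of \<open>s * t\<close> has \<open>m\<close>, \<open>m'\<close>
      or \<open>a * b\<close> as a factor of each summand.\<close>
    have "t * m + ((r * a) * m' + (r * r') * (a * b)) \<in> M"
      by (intro submod_add[OF M'] submod_mult[OF M'] mult_mem ab a(1) *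
          gv_set_mem[OF T(1) \<open>t \<in> T\<close>])
    also have "t * m + ((r * a) * m' + (r * r') * (a * b)) = s * t"
      using * by (simp add: algebra_simps)
    finally show ?thesis .
  qed
  then have "{s * t | s t. s \<in> S \<and> t \<in> T} \<subseteq> M" by blast
  then show False
    using t_Max_not_gv_set[OF M gv_set_Sigma[OF S(1), of "\<lambda>_. T"]] T(1) by blast
qed

section \<open>The \<open>w\<close>-operation\<close>

text \<open>The elements carried into \<open>I\<close> by some \<open>s\<close> outside
  \<open>M\<close> form a module over the localization; primality of \<open>M\<close> allows
  denominators to be multiplied.\<close>

lemma hull_localization_memD:
  assumes M: "M \<in> t_Max R" and I: "submod R I"
    and x: "x \<in> submod (localization R (R - M)) hull I"
  obtains s where "s \<in> R - M" "s * x \<in> I"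
proof -
  let ?L = "{x. \<exists>s\<in>R - M. s * x \<in> I}"
  have mult: "s * s' \<in> R - M" if "s \<in> R - M" "s' \<in> R - M" for s s'
    using that t_Max_prime[OF M] mult_mem by blast
  have "submod (localization R (R - M)) ?L"
  proof (rule submodI)
    show "0 \<in> ?L"
      using t_Max_not_one[OF M] one_mem submod_0[OF I] by auto
  next
    fix x y assume "x \<in> ?L" "y \<in> ?L"
    then obtain s s' where s: "s \<in> R - M" "s * x \<in> I" "s' \<in> R - M" "s' * y \<in> I"
      by blast
    then have "s' * (s * x) + s * (s' * y) \<in> I"
      using submod_add[OF I] submod_mult[OF I] by simp
    then show "x + y \<in> ?L"
      using mult[OF s(3,1)] by (intro CollectI bexI[of _ "s' * s"]) (auto simp: algebra_simps)
  next
    fix r x assume "r \<in> localization R (R - M)" "x \<in> ?L"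
    then obtain a t s where *: "r = a / t" "a \<in> R" "t \<in> R - M" "s \<in> R - M" "s * x \<in> I"
      by (auto simp: localization_def)
    then have "t \<noteq> 0"
      using submod_0[OF t_Max_submod[OF M]] by blast
    then have "(s * t) * (r * x) = a * (s * x)"
      using * by simp
    also have "\<dots> \<in> I"
      using * submod_mult[OF I] by blast
    finally show "r * x \<in> ?L"
      using mult * by blast
  qed
  moreover have "I \<subseteq> ?L"
    using t_Max_not_one[OF M] one_mem by (auto intro!: bexI[of _ 1])
  ultimately show thesis
    using x submod_hull_le that by blast
qed

text \<open>The \<open>d\<close> in \<open>R\<close> with \<open>d * x \<in> I\<close> form an
  ideal, and \<open>x\<close> lies in the localization of \<open>I\<close> at \<open>M\<close> only
  if this ideal is not inside \<open>M\<close>. If that holds at every t-maximal \<open>M\<close>,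
  it contains a GV-set. Conversely, a GV-set has an element outside each \<open>M\<close>, which is
  invertible in the localization.\<close>

lemma w_op_iff:
  assumes I: "I \<in> nz_ideals R"
  shows "x \<in> w_op R I \<longleftrightarrow> x \<in> quot_field R \<and> (\<exists>S. gv_set R S \<and> (\<forall>s\<in>S. x * s \<in> I))"
proof
  assume x: "x \<in> w_op R I"
  let ?A = "{d \<in> R. d * x \<in> I}"
  note subI = nz_ideals_submod[OF I]
  have "submod R ?A"
    by (rule submodI)
      (auto simp: distrib_right mult.assoc zero_mem submod_0[OF subI]
        intro: add_mem mult_mem submod_add[OF subI] submod_mult[OF subI])
  moreover obtain i where i: "i \<in> I" "i \<in> R" "i \<noteq> 0"
    by (rule nz_ideals_numerator[OF I])
  moreover have xq: "x \<in> quot_field R"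
    using x by (simp add: w_op_def)
  moreover obtain a b where "x = a / b" "a \<in> R" "b \<in> R" "b \<noteq> 0"
    using xq by (rule quot_fieldE)
  \<comment> \<open>The ideal of denominators is nonzero: \<open>(b * i) * x = a * i\<close> lies in
    \<open>I\<close>, and \<open>b * i\<close> lies in \<open>R\<close> because \<open>i\<close> was
    chosen in \<open>R\<close>.\<close>
  then have "b * i \<in> ?A" "b * i \<noteq> 0"
    using i mult_mem[of b i] submod_mult[OF subI, of a i] by (simp_all add: mult.commute)
  ultimately have A: "?A \<in> nz_ideals R"
    by (intro nz_ideals_integralI[of _ "b * i"]) auto
  have "\<not> ?A \<subseteq> M" if M: "M \<in> t_Max R" for M
  proof -
    have "x \<in> submod (localization R (R - M)) hull I"
      using x M by (simp add: w_op_def)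
    from hull_localization_memD[OF M subI this] show ?thesis
      by blast
  qed
  then obtain S where "gv_set R S" "S \<subseteq> ?A"
    using gv_set_if_not_in_t_Max[OF A] by blast
  then show "x \<in> quot_field R \<and> (\<exists>S. gv_set R S \<and> (\<forall>s\<in>S. x * s \<in> I))"
    using xq by (auto simp: mult.commute)
next
  assume "x \<in> quot_field R \<and> (\<exists>S. gv_set R S \<and> (\<forall>s\<in>S. x * s \<in> I))"
  then obtain S where S: "x \<in> quot_field R" "gv_set R S" "\<forall>s\<in>S. x * s \<in> I" by blast
  have "x \<in> submod (localization R (R - M)) hull I" if M: "M \<in> t_Max R" for M
  proof -
    obtain s where s: "s \<in> S" "s \<in> R - M"
      using t_Max_not_gv_set[OF M S(2)] S(2) by (auto simp: gv_set_def)
    then have "s \<noteq> 0"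
      using submod_0[OF t_Max_submod[OF M]] by blast
    have "1 / s \<in> localization R (R - M)"
      using s one_mem by (auto simp: localization_def)
    then have "1 / s * (x * s) \<in> submod (localization R (R - M)) hull I"
      using S(3) s by (intro submod_mult[OF submod_submod_hull] hull_inc) auto
    then show ?thesis
      using \<open>s \<noteq> 0\<close> by simp
  qed
  then show "x \<in> w_op R I"
    using S(1) by (simp add: w_op_def)
qed

section \<open>Closure properties of the w-operation\<close>

lemma gv_set_one: "gv_set R {1}"
  using one_mem by (auto simp: gv_set_def)

lemma w_op_extensive: "I \<in> nz_ideals R \<Longrightarrow> I \<subseteq> w_op R I"
proof
  fix x assume I: "I \<in> nz_ideals R" and "x \<in> I"
  then show "x \<in> w_op R I"
    unfolding w_op_iff[OF I] using gv_set_one nz_ideals_quot[OF I]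
    by (intro conjI exI[of _ "{1}"]) simp_all
qed

text \<open>Idempotence in elementwise form: each \<open>x * s\<close> has its own GV-set
  \<open>F s\<close> carrying it into \<open>I\<close>, and the products \<open>s * t\<close> with
  \<open>t\<close> in \<open>F s\<close> form one GV-set carrying \<open>x\<close> into
  \<open>I\<close>.\<close>

lemma w_op_closed:
  assumes I: "I \<in> nz_ideals R" and x: "x \<in> quot_field R"
    and S: "gv_set R S" "\<And>s. s \<in> S \<Longrightarrow> x * s \<in> w_op R I"
  shows "x \<in> w_op R I"
proof -
  have "\<forall>s\<in>S. \<exists>T. gv_set R T \<and> (\<forall>t\<in>T. x * s * t \<in> I)"
    using S(2) w_op_iff[OF I] by blast
  then obtain F where F: "\<And>s. s \<in> S \<Longrightarrow> gv_set R (F s) \<and> (\<forall>t\<in>F s. x * s * t \<in> I)"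
    by metis
  then have "gv_set R {s * t | s t. s \<in> S \<and> t \<in> F s}"
    using S(1) by (intro gv_set_Sigma) auto
  moreover have "\<forall>u\<in>{s * t | s t. s \<in> S \<and> t \<in> F s}. x * u \<in> I"
    using F by (auto simp: mult.assoc)
  ultimately show ?thesis
    unfolding w_op_iff[OF I] using x by blast
qed

lemma w_op_minimal:
  assumes "I \<in> nz_ideals R" "J \<in> nz_ideals R" "I \<subseteq> w_op R J"
  shows "w_op R I \<subseteq> w_op R J"
proof
  fix x assume "x \<in> w_op R I"
  then obtain S where "x \<in> quot_field R" "gv_set R S" "\<forall>s\<in>S. x * s \<in> I"
    using w_op_iff[OF assms(1)] by blast
  then show "x \<in> w_op R J"
    using assms(3) by (intro w_op_closed[OF assms(2), of x S]) auto
qed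

lemma submod_w_op:
  assumes I: "I \<in> nz_ideals R"
  shows "submod R (w_op R I)"
proof (rule submodI)
  show "0 \<in> w_op R I"
    using w_op_extensive[OF I] submod_0[OF nz_ideals_submod[OF I]] by blast
next
  fix x y assume "x \<in> w_op R I" "y \<in> w_op R I"
  then obtain S T where *: "x \<in> quot_field R" "y \<in> quot_field R" "gv_set R S" "gv_set R T"
    "\<forall>s\<in>S. x * s \<in> I" "\<forall>s\<in>T. y * s \<in> I"
    using w_op_iff[OF I] by auto
  note sub = nz_ideals_submod[OF I]
  have "gv_set R {s * t | s t. s \<in> S \<and> t \<in> T}"
    using gv_set_Sigma[of S "\<lambda>_. T"] * by blast
  moreover have "(x + y) * (s * t) \<in> I" if "s \<in> S" "t \<in> T" for s t
  proof -
    have "t * (x * s) + s * (y * t) \<in> I"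
      using gv_set_mem[OF *(3) that(1)] gv_set_mem[OF *(4) that(2)] *(5,6) that
      by (intro submod_add[OF sub] submod_mult[OF sub, of t] submod_mult[OF sub, of s]) simp_all
    then show ?thesis by (simp add: algebra_simps)
  qed
  ultimately show "x + y \<in> w_op R I"
    using * quot_add w_op_iff[OF I] by blast
next
  fix r x assume "r \<in> R" "x \<in> w_op R I"
  then obtain S where "x \<in> quot_field R" "gv_set R S" "\<forall>s\<in>S. x * s \<in> I"
    using w_op_iff[OF I] by blast
  with \<open>r \<in> R\<close> show "r * x \<in> w_op R I"
    unfolding w_op_iff[OF I] using submod_mult[OF nz_ideals_submod[OF I]]
    by (intro conjI exI[of _ S]) (simp_all add: mult.assoc quot_mult quot_of_mem)
qed

text \<open>A denominator \<open>d\<close> of \<open>I\<close> also serves for the w-closure: if a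
  GV-set carries \<open>x\<close> into \<open>I\<close>, it carries \<open>d * x\<close> into
  \<open>R\<close>, so \<open>d * x\<close> is in \<open>R\<close>.\<close>

lemma w_op_nz_ideals:
  assumes I: "I \<in> nz_ideals R"
  shows "w_op R I \<in> nz_ideals R"
proof -
  obtain d where d: "d \<in> R" "d \<noteq> 0" "\<And>x. x \<in> I \<Longrightarrow> d * x \<in> R"
    using nz_ideals_denom[OF I] by metis
  have "d * x \<in> R" if xw: "x \<in> w_op R I" for x
  proof -
    obtain S where S: "gv_set R S" "\<forall>s\<in>S. x * s \<in> I" and x: "x \<in> quot_field R"
      using xw w_op_iff[OF I] by blast
    show ?thesis
      by (rule gv_setD[OF S(1) quot_mult[OF quot_of_mem[OF d(1)] x]])
        (use d(3) S(2) in \<open>simp add: mult.assoc\<close>)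
  qed
  moreover obtain i where "i \<in> I" "i \<noteq> 0"
    by (rule nz_ideals_nonzero[OF I])
  ultimately show ?thesis
    unfolding nz_ideals_iff using d(1,2) submod_w_op[OF I] w_op_extensive[OF I]
    by (intro conjI bexI[of _ d] bexI[of _ i]) (auto simp: w_op_def)
qed

text \<open>A GV-set that carries \<open>x\<close> into the endomorphism ring carries
  \<open>x * h\<close> into \<open>w_op R I\<close> for each \<open>h\<close> there, and the
  w-closure absorbs GV-sets.\<close>

lemma endo_w_op_closed:
  assumes I: "I \<in> nz_ideals R"
  shows "w_op R (endo R (w_op R I)) \<subseteq> endo R (w_op R I)"
proof
  note H = w_op_nz_ideals[OF I]
  fix x assume x: "x \<in> w_op R (endo R (w_op R I))"
  then obtain S where S: "gv_set R S" "\<forall>s\<in>S. x * s \<in> endo R (w_op R I)" and xq: "x \<in> quot_field R"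
    unfolding endo_def using w_op_iff[OF colon_nz_ideals[OF H H]] by blast
  have "x * h \<in> w_op R I" if h: "h \<in> w_op R I" for h
  proof (rule w_op_closed[OF I quot_mult[OF xq nz_ideals_quot[OF H h]] S(1)])
    fix s assume "s \<in> S"
    then have "x * s * h \<in> w_op R I"
      using S(2) h by (auto simp: endo_def colon_def)
    then show "x * h * s \<in> w_op R I" by (simp add: ac_simps)
  qed
  then show "x \<in> endo R (w_op R I)"
    using xq by (auto simp: endo_def colon_def)
qed

text \<open>Of the equation defining w-stability only the membership of 1 is kept; a GV-set carrying
  1 into the product is a subset of the product. This finite datum is what passes to extension
  rings.\<close>

lemma w_stable_gv_set:
  assumes I: "I \<in> nz_ideals R" and w: "w_stable R I" and L: "L = w_op R I"
  obtains S where "gv_set R S" "S \<subseteq> ideal_prod R L (colon R (endo R L) L)"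
proof -
  have L': "L \<in> nz_ideals R"
    using w_op_nz_ideals[OF I] by (simp add: L)
  then have P: "ideal_prod R L (colon R (endo R L) L) \<in> nz_ideals R"
    unfolding endo_def by (intro ideal_prod_nz_ideals colon_nz_ideals)
  have "1 \<in> w_op R (ideal_prod R L (colon R (endo R L) L))"
    using w one_mem_endo[of L] by (simp add: w_stable_def Let_def L)
  then show thesis
    unfolding w_op_iff[OF P] by (auto intro: that)
qed

text \<open>Conversely, \<open>e * S\<close> stays in the product for every \<open>e\<close> in
  \<open>endo R H\<close>, so \<open>e\<close> is in its w-closure. The other inclusion holds
  because \<open>endo R H\<close> is w-closed.\<close>

lemma w_stableI:
  assumes I: "I \<in> nz_ideals R" and H: "H = w_op R I"
    and S: "gv_set R S" "S \<subseteq> ideal_prod R H (colon R (endo R H) H)"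
  shows "w_stable R I"
proof -
  let ?P = "ideal_prod R H (colon R (endo R H) H)"
  have H': "H \<in> nz_ideals R"
    using w_op_nz_ideals[OF I] by (simp add: H)
  then have E: "endo R H \<in> nz_ideals R"
    unfolding endo_def by (rule colon_nz_ideals[OF H'])
  then have P: "?P \<in> nz_ideals R"
    by (intro ideal_prod_nz_ideals colon_nz_ideals H')
  have "endo R H \<subseteq> w_op R ?P"
  proof
    fix e assume e: "e \<in> endo R H"
    then have "\<forall>s\<in>S. e * s \<in> ?P"
      using ideal_prod_colon_endo_closed[OF nz_ideals_submod[OF H'] e] S(2) by blast
    then show "e \<in> w_op R ?P"
      unfolding w_op_iff[OF P] using S(1) nz_ideals_quot[OF E e] by blast
  qed
  moreover have "?P \<subseteq> w_op R (endo R H)"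
    using ideal_prod_colon_endo_le[OF nz_ideals_submod[OF H']] w_op_extensive[OF E] by blast
  then have "w_op R ?P \<subseteq> w_op R (endo R H)"
    by (rule w_op_minimal[OF P E])
  ultimately have "w_op R ?P = endo R H"
    using endo_w_op_closed[OF I] by (auto simp: H)
  then show ?thesis
    by (simp add: w_stable_def Let_def H)
qed

lemma stable_idealI:
  assumes I: "submod R I" and one: "1 \<in> ideal_prod R I (colon R (endo R I) I)"
  shows "stable_ideal R I"
  unfolding stable_ideal_def
  using ideal_prod_colon_endo_le[OF I] ideal_prod_colon_endo_closed[OF I _ one] by auto

end

section \<open>Extended ideals\<close>

abbreviation const :: "'k::field \<Rightarrow> 'k poly fract" where
  "const a \<equiv> to_fract [:a:]"

section \<open>Constants in the field of rational functions\<close>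

lemma const_add: "const (a + b) = const a + const b"
  and const_mult: "const (a * b) = const a * const b"
  by (simp_all flip: to_fract_add to_fract_mult)

lemma const_divide: "b \<noteq> 0 \<Longrightarrow> const (a / b) = const a / const b"
  by (simp add: eq_divide_eq flip: const_mult)

text \<open>Instantiated with \<open>T\<close> the polynomial ring and with \<open>T\<close> the
  Nagata ring, so that what does not depend on the choice of \<open>T\<close> is proved
  once.\<close>

locale ring_extension =
  D: domain_in_field D + T: domain_in_field T
  for D :: "'k::field set" and T :: "'k poly fract set" +
  assumes const_mem: "a \<in> D \<Longrightarrow> const a \<in> T"
begin

abbreviation extend :: "'k set \<Rightarrow> 'k poly fract set" where
  "extend I \<equiv> submod T hull (const ` I)"

lemma const_quot: "a \<in> quot_field D \<Longrightarrow> const a \<in> quot_field T"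
  by (elim quot_fieldE) (simp add: const_divide quot_field_memI const_mem)

lemma const_mem_extend: "a \<in> I \<Longrightarrow> const a \<in> extend I"
  by (intro hull_inc imageI)

lemma extend_le: "submod T M \<Longrightarrow> (\<And>a. a \<in> I \<Longrightarrow> const a \<in> M) \<Longrightarrow> extend I \<subseteq> M"
  by (intro submod_hull_le) auto

text \<open>Pulling a \<open>T\<close>-module back to \<open>D\<close> reduces an inclusion of an
  ideal product of \<open>D\<close> to products of two elements.\<close>

lemma submod_const_vimage: "submod T M \<Longrightarrow> submod D (const -` M)"
  by (rule submodI) (auto simp: const_add const_mult const_mem submod_0 submod_add submod_mult)

lemma extend_nz_ideals:
  assumes I: "I \<in> nz_ideals D"
  shows "extend I \<in> nz_ideals T"
proof -
  obtain d where d: "d \<in> D" "d \<noteq> 0" "\<And>x. x \<in> I \<Longrightarrow> d * x \<in> D"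
    using nz_ideals_denom[OF I] by metis
  have "extend I \<subseteq> {x. \<forall>b\<in>{const d}. x * b \<in> T}"
  proof (rule extend_le[OF submod_residual[OF T.submod_self]])
    fix a assume "a \<in> I"
    then show "const a \<in> {x. \<forall>b\<in>{const d}. x * b \<in> T}"
      using const_mem[OF d(3)] by (simp add: mult.commute flip: const_mult)
  qed
  then have "\<forall>x\<in>extend I. const d * x \<in> T"
    by (auto simp: mult.commute)
  moreover have "extend I \<subseteq> quot_field T"
    by (rule extend_le[OF T.submod_quot]) (rule const_quot[OF nz_ideals_quot[OF I]])
  moreover obtain i where "i \<in> I" "i \<noteq> 0"
    by (rule nz_ideals_nonzero[OF I])
  ultimately show ?thesis
    unfolding nz_ideals_iff using d const_mem_extend[of i I]
    by (intro conjI bexI[of _ "const d"] bexI[of _ "const i"])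
      (simp_all add: submod_submod_hull const_mem)
qed

lemma extended_idealsE:
  assumes "H \<in> extended_ideals D T" "H \<noteq> {0}"
  obtains I where "I \<in> nz_ideals D" "H = extend I"
proof -
  obtain I where I: "frac_ideal D I" "H = extend I"
    using assms(1) by (auto simp: extended_ideals_def)
  have "extend {0} = {0}"
    using hull_same[of "submod T" "{0}"] by (simp add: submod_def)
  then have "I \<noteq> {0}"
    using I(2) assms(2) by metis
  with I that show thesis
    by (simp add: nz_ideals_def)
qed

lemma ideal_prod_extend:
  "ideal_prod T (extend I) (extend J) = extend (ideal_prod D I J)"
proof
  show "ideal_prod T (extend I) (extend J) \<subseteq> extend (ideal_prod D I J)"
  proof (rule ideal_prod_le[OF submod_submod_hull])
    fix x y assume x: "x \<in> extend I" and y: "y \<in> extend J"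
    have "1 * x * y \<in> extend (ideal_prod D I J)"
    proof (rule hull_mult_mem[OF submod_submod_hull _ x y])
      fix u v assume "u \<in> const ` I" "v \<in> const ` J"
      then obtain a b where "u = const a" "v = const b" "a \<in> I" "b \<in> J"
        by blast
      then show "1 * u * v \<in> extend (ideal_prod D I J)"
        using const_mem_extend[OF ideal_prod_memI[of a I b J D]] by (simp add: const_mult)
    qed
    then show "x * y \<in> extend (ideal_prod D I J)" by simp
  qed
  have "ideal_prod D I J \<subseteq> const -` ideal_prod T (extend I) (extend J)"
    by (rule ideal_prod_le[OF submod_const_vimage[OF submod_ideal_prod]])
      (simp add: const_mult ideal_prod_memI const_mem_extend)
  then show "extend (ideal_prod D I J) \<subseteq> ideal_prod T (extend I) (extend J)"
    by (intro extend_le submod_ideal_prod) auto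
qed

text \<open>An \<open>x\<close> in \<open>(E : L)\<close> with \<open>E = (L : L)\<close> satisfies
  \<open>x L L \<subseteq> L\<close>, and this condition spreads from constants to the modules they
  generate. The factors run through the extension of \<open>I\<close> only, since \<open>H\<close>
  may be a larger w-closure.\<close>

lemma const_colon_endo_mult_mem:
  assumes H: "submod T H" and "I \<subseteq> L" and L: "\<And>a. a \<in> L \<Longrightarrow> const a \<in> H"
    and x: "x \<in> colon D (endo D L) L" and ab: "a \<in> extend I" "b \<in> extend I"
  shows "const x * a * b \<in> H"
proof (rule hull_mult_mem[OF H _ ab])
  fix u v assume "u \<in> const ` I" "v \<in> const ` I"
  then obtain a b where *: "u = const a" "v = const b" "a \<in> L" "b \<in> L"
    using \<open>I \<subseteq> L\<close> by blast
  then have "x * a * b \<in> L"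
    using x by (auto simp: endo_def colon_def)
  then show "const x * u * v \<in> H"
    using L[of "x * a * b"] * by (simp add: const_mult)
qed

text \<open>Hypothesis \<open>C\<close> is where the two rings differ: in the Nagata ring it follows
  directly from \<open>const_colon_endo_mult_mem\<close>, in the polynomial ring a passage to
  w-closures intervenes.\<close>

lemma const_ideal_prod_colon_endo:
  assumes L: "\<And>a. a \<in> L \<Longrightarrow> const a \<in> H"
    and C: "\<And>x. x \<in> colon D (endo D L) L \<Longrightarrow> const x \<in> colon T (endo T H) H"
    and y: "y \<in> ideal_prod D L (colon D (endo D L) L)"
  shows "const y \<in> ideal_prod T H (colon T (endo T H) H)" (is "_ \<in> ?P")
proof -
  have "ideal_prod D L (colon D (endo D L) L) \<subseteq> const -` ?P"
    by (rule ideal_prod_le[OF submod_const_vimage[OF submod_ideal_prod]])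
      (simp add: const_mult ideal_prod_memI L C)
  then show ?thesis
    using y by blast
qed

end

section \<open>Polynomial rings\<close>

context domain_in_field
begin

lemma polys_over_mult: "p \<in> polys_over R \<Longrightarrow> q \<in> polys_over R \<Longrightarrow> p * q \<in> polys_over R"
  by (auto simp: polys_over_def coeff_mult intro!: submod_sum[OF submod_self] mult_mem)

lemma polys_over_diff: "p \<in> polys_over R \<Longrightarrow> q \<in> polys_over R \<Longrightarrow> p - q \<in> polys_over R"
  by (auto simp: polys_over_def intro!: diff_mem)

lemma polys_over_const: "a \<in> R \<Longrightarrow> [:a:] \<in> polys_over R"
  by (auto simp: polys_over_def coeff_pCons zero_mem split: nat.split)

lemma to_fract_mem_poly_ring_iff: "to_fract p \<in> poly_ring R \<longleftrightarrow> p \<in> polys_over R"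
  by (auto simp: poly_ring_def)

lemma is_domain_poly_ring: "is_domain (poly_ring R)"
proof -
  have "to_fract [:1:] \<in> poly_ring R"
    using polys_over_const[OF one_mem] by (simp only: to_fract_mem_poly_ring_iff)
  then show ?thesis
    unfolding is_domain_def
    by (auto simp: poly_ring_def polys_over_diff polys_over_mult one_pCons[symmetric]
        simp flip: to_fract_diff to_fract_mult)
qed

end

text \<open>Over a field even the empty set and \<open>{0}\<close> are GV-sets; excluding fields
  rules them out.\<close>

locale proper_domain = domain_in_field +
  assumes not_field: "\<exists>d\<in>R. d \<noteq> 0 \<and> inverse d \<notin> R"
begin

sublocale poly: ring_extension R "poly_ring R"
  by unfold_locales (simp_all add: is_domain_poly_ring to_fract_mem_poly_ring_iff polys_over_const)

text \<open>For a nonzero nonunit \<open>d\<close>, some \<open>s\<close> in \<open>S\<close> has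
  \<open>inverse d * s\<close> outside \<open>R\<close>, so \<open>s\<close> is not 0.\<close>

lemma gv_set_nonzero:
  assumes S: "gv_set R S"
  obtains s where "s \<in> S" "s \<noteq> 0"
proof -
  obtain d where d: "d \<in> R" "inverse d \<notin> R"
    using not_field by blast
  have "\<exists>s\<in>S. inverse d * s \<notin> R"
    using gv_setD[OF S quot_inverse[OF quot_of_mem[OF d(1)]]] d(2) by blast
  then show thesis
    using that zero_mem by force
qed

text \<open>One nonzero \<open>s\<close> in \<open>S\<close> shows that \<open>f\<close> is a
  polynomial over the quotient field: divide the polynomial \<open>f * const s\<close> by
  \<open>s\<close>. Constants multiply coefficientwise, so the GV property of \<open>S\<close> then
  puts each coefficient in \<open>R\<close>.\<close>

lemma gv_set_poly_ring:
  assumes S: "gv_set R S"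
  shows "gv_set (poly_ring R) (const ` S)"
proof -
  have "f \<in> poly_ring R"
    if f: "\<And>s. s \<in> S \<Longrightarrow> f * const s \<in> poly_ring R" for f
  proof -
    obtain s where s: "s \<in> S" "s \<noteq> 0"
      by (rule gv_set_nonzero[OF S])
    obtain g where g: "f * const s = to_fract g" "g \<in> polys_over R"
      using f[OF s(1)] by (auto simp: poly_ring_def)
    define p where "p = smult (inverse s) g"
    have f_eq: "f = to_fract p"
    proof -
      have "p * [:s:] = g"
        using s by (simp add: p_def)
      then have "to_fract p * const s = f * const s"
        using g by (metis to_fract_mult)
      then show ?thesis
        using s by simp
    qed
    have "coeff p i \<in> R" for i
    proof (rule gv_setD[OF S])
      show "coeff p i \<in> quot_field R"
        using g(2) quot_mult[OF quot_inverse[OF quot_of_mem[OF gv_set_mem[OF S s(1)]]] quot_of_mem]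
        by (simp add: p_def polys_over_def)
      fix t assume "t \<in> S"
      then have "to_fract (p * [:t:]) \<in> poly_ring R"
        using f unfolding f_eq to_fract_mult by blast
      then have "p * [:t:] \<in> polys_over R"
        by (simp only: to_fract_mem_poly_ring_iff)
      then have "coeff (p * [:t:]) i \<in> R"
        by (simp only: polys_over_def mem_Collect_eq)
      then show "coeff p i * t \<in> R"
        by (simp add: mult.commute)
    qed
    then show ?thesis
      by (simp add: f_eq to_fract_mem_poly_ring_iff polys_over_def)
  qed
  then show ?thesis
    using S poly.const_mem by (auto simp: gv_set_def)
qed

lemma const_w_op_mem:
  assumes A: "A \<in> nz_ideals R" and x: "x \<in> w_op R A"
  shows "const x \<in> w_op (poly_ring R) (poly.extend A)"
proof -
  obtain S where S: "gv_set R S" "\<forall>s\<in>S. x * s \<in> A" and xq: "x \<in> quot_field R"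
    using x w_op_iff[OF A] by blast
  have "\<forall>t\<in>const ` S. const x * t \<in> poly.extend A"
    using S(2) poly.const_mem_extend by (auto simp flip: const_mult)
  then show ?thesis
    unfolding poly.T.w_op_iff[OF poly.extend_nz_ideals[OF A]]
    using gv_set_poly_ring[OF S(1)] poly.const_quot[OF xq] by blast
qed

lemma w_op_extend_le:
  assumes A: "A \<in> nz_ideals R" and B: "B \<in> nz_ideals R" and eq: "w_op R A = w_op R B"
  shows "w_op (poly_ring R) (poly.extend A) \<subseteq> w_op (poly_ring R) (poly.extend B)"
proof (rule poly.T.w_op_minimal[OF poly.extend_nz_ideals[OF A] poly.extend_nz_ideals[OF B]])
  show "poly.extend A \<subseteq> w_op (poly_ring R) (poly.extend B)"
    using const_w_op_mem[OF B] w_op_extensive[OF A] eq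
    by (intro poly.extend_le poly.T.submod_w_op poly.extend_nz_ideals[OF B]) auto
qed

lemma w_regular_extend:
  assumes I: "I \<in> nz_ideals R" and w: "w_regular R I"
  shows "w_regular (poly_ring R) (poly.extend I)"
proof -
  obtain J where J: "J \<in> nz_ideals R" and eq: "w_op R I = w_op R (ideal_prod R (ideal_prod R I I) J)"
    using w by (auto simp: w_regular_def)
  note P = ideal_prod_nz_ideals[OF ideal_prod_nz_ideals[OF I I] J]
  show ?thesis
    unfolding w_regular_def
  proof (rule bexI[OF _ poly.extend_nz_ideals[OF J]])
    show "w_op (poly_ring R) (poly.extend I) =
      w_op (poly_ring R) (ideal_prod (poly_ring R)
        (ideal_prod (poly_ring R) (poly.extend I) (poly.extend I)) (poly.extend J))"
      unfolding poly.ideal_prod_extend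
      using w_op_extend_le[OF I P eq] w_op_extend_le[OF P I eq[symmetric]] by blast
  qed
qed

text \<open>With \<open>L\<close> and \<open>H\<close> the w-closures of \<open>I\<close> and of its
  extension, the point is that \<open>x L L \<subseteq> L\<close> implies the same relation for
  \<open>const x\<close> and \<open>H\<close>. The GV-set inside the product for \<open>L\<close> is
  then mapped into the product for \<open>H\<close>.\<close>

lemma w_stable_extend:
  assumes I: "I \<in> nz_ideals R" and w: "w_stable R I"
  shows "w_stable (poly_ring R) (poly.extend I)"
proof -
  define L where "L = w_op R I"
  define H where "H = w_op (poly_ring R) (poly.extend I)"
  note eI = poly.extend_nz_ideals[OF I]
  have H: "H \<in> nz_ideals (poly_ring R)"
    unfolding H_def by (rule poly.T.w_op_nz_ideals[OF eI])
  have LH: "const a \<in> H" if "a \<in> L" for a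
    using const_w_op_mem[OF I] that by (simp add: L_def H_def)
  have IL: "I \<subseteq> L"
    unfolding L_def by (rule w_op_extensive[OF I])
  have LQ: "x \<in> quot_field R" if "x \<in> colon R (endo R L) L" for x
    using that by (simp add: colon_def)
  \<comment> \<open>A multiplier that sends the extension of \<open>I\<close> into \<open>H\<close>
    sends all of \<open>H\<close> into \<open>H\<close>: a GV-set carries \<open>h\<close> into the
    extension, and \<open>H\<close> is w-closed.\<close>
  have closed: "z * h \<in> H"
    if z: "z \<in> quot_field (poly_ring R)" and h: "h \<in> H"
      and mem: "\<And>a. a \<in> poly.extend I \<Longrightarrow> z * a \<in> H" for z h
  proof -
    obtain S where S: "gv_set (poly_ring R) S" "\<forall>s\<in>S. h * s \<in> poly.extend I"
      using h unfolding H_def poly.T.w_op_iff[OF eI] by blast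
    show ?thesis
      unfolding H_def
    proof (rule poly.T.w_op_closed[OF eI poly.T.quot_mult[OF z nz_ideals_quot[OF H h]] S(1)])
      fix s assume "s \<in> S"
      then show "z * h * s \<in> w_op (poly_ring R) (poly.extend I)"
        using mem[of "h * s"] S(2) by (simp add: H_def mult.assoc)
    qed
  qed
  have "const x \<in> colon (poly_ring R) (endo (poly_ring R) H) H"
    if x: "x \<in> colon R (endo R L) L" for x
  proof -
    note xq = poly.const_quot[OF LQ[OF x]]
    \<comment> \<open>The two factors are enlarged from the extension of \<open>I\<close> to
      \<open>H\<close> one after the other, using \<open>closed\<close> with
      \<open>z = const x * a\<close> and then with \<open>z = const x * h\<close>.\<close>
    have 1: "const x * a * h \<in> H" if a: "a \<in> poly.extend I" and h: "h \<in> H" for a h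
      using poly.const_colon_endo_mult_mem[OF nz_ideals_submod[OF H] IL LH x a]
      by (intro closed[OF poly.T.quot_mult[OF xq nz_ideals_quot[OF eI a]] h])
    have 2: "const x * h' * h \<in> H" if "h \<in> H" "h' \<in> H" for h h'
    proof -
      have "const x * h * h' \<in> H"
        using 1[OF _ that(1)]
        by (intro closed[OF poly.T.quot_mult[OF xq nz_ideals_quot[OF H that(1)]] that(2)])
          (simp add: ac_simps)
      then show ?thesis by (simp add: ac_simps)
    qed
    show ?thesis
      using 2 xq nz_ideals_quot[OF H] poly.T.quot_mult[OF xq]
      by (simp add: colon_def endo_def)
  qed
  then have P: "const y \<in> ideal_prod (poly_ring R) H (colon (poly_ring R) (endo (poly_ring R) H) H)"
    if "y \<in> ideal_prod R L (colon R (endo R L) L)" for y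
    using poly.const_ideal_prod_colon_endo[OF LH _ that] by blast
  obtain S where S: "gv_set R S" "S \<subseteq> ideal_prod R L (colon R (endo R L) L)"
    by (rule w_stable_gv_set[OF I w L_def])
  show ?thesis
    by (rule poly.T.w_stableI[OF eI H_def gv_set_poly_ring[OF S(1)]]) (use S(2) P in blast)
qed

end

section \<open>The Nagata ring\<close>

context domain_in_field
begin

text \<open>Compare the lowest coefficients of the factors that lie outside \<open>M\<close>.\<close>

lemma t_Max_coeff_mult:
  assumes M: "M \<in> t_Max R" and p: "p \<in> polys_over R" and q: "q \<in> polys_over R"
    and p': "\<not> range (coeff p) \<subseteq> M" and q': "\<not> range (coeff q) \<subseteq> M"
  shows "\<not> range (coeff (p * q)) \<subseteq> M"
proof
  assume pq: "range (coeff (p * q)) \<subseteq> M"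
  note sub = t_Max_submod[OF M]
  have least: "\<exists>i. coeff r i \<notin> M \<and> (\<forall>l<i. coeff r l \<in> M)" if "\<not> range (coeff r) \<subseteq> M" for r
  proof -
    have "\<exists>i. coeff r i \<notin> M"
      using that by blast
    then show ?thesis
      by (subst (asm) exists_least_iff) simp
  qed
  obtain i where i: "coeff p i \<notin> M" "\<And>l. l < i \<Longrightarrow> coeff p l \<in> M"
    using least[OF p'] by blast
  obtain j where j: "coeff q j \<notin> M" "\<And>l. l < j \<Longrightarrow> coeff q l \<in> M"
    using least[OF q'] by blast
  have pR: "coeff p l \<in> R" and qR: "coeff q l \<in> R" for l
    using p q by (auto simp: polys_over_def)
  let ?rest = "\<Sum>l\<in>{..i + j} - {i}. coeff p l * coeff q (i + j - l)"
  have "coeff p l * coeff q (i + j - l) \<in> M" if "l \<in> {..i + j} - {i}" for l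
  proof (cases "l < i")
    case True
    show ?thesis
      by (rule submod_mult_right[OF sub qR i(2)[OF True]])
  next
    case False
    then have "i + j - l < j" using that by auto
    then show ?thesis
      by (rule submod_mult[OF sub pR j(2)])
  qed
  then have rest: "?rest \<in> M"
    by (rule submod_sum[OF sub])
  have "coeff (p * q) (i + j) = coeff p i * coeff q j + ?rest"
    unfolding coeff_mult by (subst sum.remove[of _ i]) auto
  then have "coeff p i * coeff q j = coeff (p * q) (i + j) + (- 1) * ?rest"
    by simp
  also have "\<dots> \<in> M"
    using pq rest uminus_mem[OF one_mem] by (intro submod_add[OF sub] submod_mult[OF sub]) auto
  finally show False
    using t_Max_prime[OF M pR i(1) qR j(1)] by blast
qed

lemma gv_set_superset: "gv_set R S \<Longrightarrow> S \<subseteq> S' \<Longrightarrow> finite S' \<Longrightarrow> S' \<subseteq> R \<Longrightarrow> gv_set R S'"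
  unfolding gv_set_iff using v_op_mono[of S S'] by blast

end

section \<open>Polynomials whose content has trivial v-closure\<close>

lemma finite_range_coeff: "finite (range (coeff p))"
proof (rule finite_subset)
  show "range (coeff p) \<subseteq> insert 0 (coeff p ` {..degree p})"
    using coeff_eq_0[of p] by (auto simp: not_le[symmetric])
qed simp

context proper_domain
begin

text \<open>The v-closure of the content depends only on its finitely many generators, the
  coefficients; a GV-set has a nonzero element, which gives \<open>h \<noteq> 0\<close>.\<close>

lemma N_v_iff: "h \<in> N_v R \<longleftrightarrow> gv_set R (range (coeff h))"
proof -
  have "v_op R (content_ideal R h) = R \<longleftrightarrow> gv_set R (range (coeff h))" if "h \<in> polys_over R"
  proof -
    have "range (coeff h) \<subseteq> R"
      using that by (auto simp: polys_over_def)
    then show ?thesis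
      using finite_range_coeff[of h]
      by (simp add: content_ideal_def v_op_hull v_op_eq_iff gv_set_iff)
  qed
  moreover have "h \<in> polys_over R" if "gv_set R (range (coeff h))"
    using gv_set_mem[OF that] by (auto simp: polys_over_def)
  moreover have "h \<noteq> 0" if "gv_set R (range (coeff h))"
    by (rule gv_set_nonzero[OF that]) auto
  ultimately show ?thesis
    unfolding N_v_def by blast
qed

lemma N_v_D: "h \<in> N_v R \<Longrightarrow> h \<in> polys_over R" "h \<in> N_v R \<Longrightarrow> h \<noteq> 0"
  by (auto simp: N_v_def)

lemma one_mem_N_v: "1 \<in> N_v R"
  unfolding N_v_iff
proof (rule gv_set_superset[OF gv_set_one _ finite_range_coeff])
  show "{1} \<subseteq> range (coeff (1 :: 'a poly))"
    by (auto intro: range_eqI[of _ _ 0])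
  show "range (coeff (1 :: 'a poly)) \<subseteq> R"
    using one_mem zero_mem by (auto simp: coeff_1)
qed

text \<open>Neither factor has all its coefficients in a t-maximal ideal, hence neither does the
  product. The content of \<open>p * q\<close> therefore contains a GV-set, which puts 1 in its
  v-closure.\<close>

lemma N_v_mult:
  assumes p: "p \<in> N_v R" and q: "q \<in> N_v R"
  shows "p * q \<in> N_v R"
proof -
  let ?C = "range (coeff (p * q))"
  let ?A = "submod R hull ?C"
  have CR: "?C \<subseteq> R"
    using polys_over_mult[OF N_v_D(1)[OF p] N_v_D(1)[OF q]] by (auto simp: polys_over_def)
  have AR: "?A \<subseteq> R"
    by (rule submod_hull_le[OF submod_self CR])
  have CA: "?C \<subseteq> ?A"
    by (rule hull_subset)
  have "coeff (p * q) (degree (p * q)) \<noteq> 0"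
    using N_v_D(2)[OF p] N_v_D(2)[OF q] by (simp only: leading_coeff_0_iff mult_eq_0_iff simp_thms)
  then have A: "?A \<in> nz_ideals R"
    using CA
    by (intro nz_ideals_integralI[OF submod_submod_hull AR, of "coeff (p * q) (degree (p * q))"]) auto
  have "\<not> ?A \<subseteq> M" if M: "M \<in> t_Max R" for M
    using t_Max_coeff_mult[OF M N_v_D(1)[OF p] N_v_D(1)[OF q]] p q CA
      t_Max_not_gv_set[OF M] unfolding N_v_iff by blast
  then obtain S where S: "gv_set R S" "S \<subseteq> ?A"
    using gv_set_if_not_in_t_Max[OF A AR] by blast
  then have "1 \<in> v_op R ?C"
    using v_op_mono[OF S(2)] unfolding gv_set_iff v_op_hull by blast
  then show ?thesis
    using CR finite_range_coeff[of "p * q"] by (simp add: N_v_iff gv_set_iff)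
qed

section \<open>The Nagata ring as an extension of the domain\<close>

lemma Na_v_iff: "x \<in> Na_v R \<longleftrightarrow> (\<exists>p\<in>polys_over R. \<exists>h\<in>N_v R. x = to_fract p / to_fract h)"
  by (auto simp: Na_v_def localization_def poly_ring_def)

lemma poly_ring_le_Na_v: "poly_ring R \<subseteq> Na_v R"
  using one_mem_N_v by (force simp: Na_v_iff poly_ring_def)

lemma is_domain_Na_v: "is_domain (Na_v R)"
  unfolding is_domain_def
proof (intro conjI ballI)
  show "1 \<in> Na_v R"
    using poly_ring_le_Na_v poly.T.one_mem by blast
  fix x y assume "x \<in> Na_v R" "y \<in> Na_v R"
  then obtain p h q g where *: "p \<in> polys_over R" "h \<in> N_v R" "x = to_fract p / to_fract h"
    "q \<in> polys_over R" "g \<in> N_v R" "y = to_fract q / to_fract g"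
    unfolding Na_v_iff by blast
  then have "x - y = to_fract (p * g - q * h) / to_fract (h * g)"
    using N_v_D(2)[of h] N_v_D(2)[of g] by (simp add: diff_frac_eq)
  moreover have "p * g - q * h \<in> polys_over R"
    using * N_v_D(1) by (intro polys_over_diff polys_over_mult) auto
  ultimately show "x - y \<in> Na_v R"
    unfolding Na_v_iff using N_v_mult[of h g] * by blast
  have "x * y = to_fract (p * q) / to_fract (h * g)"
    using * by simp
  then show "x * y \<in> Na_v R"
    unfolding Na_v_iff using N_v_mult[of h g] polys_over_mult[of p q] * by blast
qed

sublocale Na: ring_extension R "Na_v R"
  using is_domain_Na_v poly.const_mem poly_ring_le_Na_v by unfold_locales auto

text \<open>Horner's scheme: \<open>z * to_fract p\<close> is built from the elements
  \<open>z * const (coeff p i)\<close> by addition and multiplication by the indeterminate, a scalar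
  of the polynomial ring.\<close>

lemma to_fract_mult_mem:
  assumes P: "submod (poly_ring R) P" and "\<And>i. z * const (coeff p i) \<in> P"
  shows "z * to_fract p \<in> P"
  using assms(2)
proof (induction p)
  case 0
  then show ?case by (simp add: submod_0[OF P])
next
  case (pCons a p)
  have X: "[:0, 1:] \<in> polys_over R"
    using zero_mem one_mem by (auto simp: polys_over_def coeff_pCons split: nat.split)
  have eq: "pCons a p = [:a:] + [:0, 1:] * p"
    by simp
  have "z * const a \<in> P"
    using pCons.prems[of 0] by simp
  moreover have "z * to_fract p \<in> P"
    using pCons.prems[of "Suc _"] by (intro pCons.IH) simp
  then have "to_fract [:0, 1:] * (z * to_fract p) \<in> P"
    by (rule submod_mult[OF P, rotated]) (simp only: X to_fract_mem_poly_ring_iff)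
  ultimately show ?case
    unfolding eq to_fract_add to_fract_mult distrib_left
    by (simp only: submod_add[OF P] mult.left_commute)
qed

text \<open>A polynomial whose coefficients run through \<open>S\<close> lies in \<open>N_v\<close> and so is a unit.\<close>

lemma Na_v_gv_set_closed:
  assumes S: "gv_set R S" and P: "submod (Na_v R) P" and z: "\<And>s. s \<in> S \<Longrightarrow> z * const s \<in> P"
  shows "z \<in> P"
proof -
  obtain xs where xs: "set xs = S"
    using S finite_list[of S] unfolding gv_set_def by blast
  define h where "h = Poly xs"
  have coeff_h: "coeff h i = (if i < length xs then xs ! i else 0)" for i
    by (simp add: h_def coeff_Poly_eq nth_default_def)
  \<comment> \<open>The coefficients of \<open>h\<close> are the elements of \<open>S\<close>
    together with 0, hence the passage to a superset.\<close>
  have "gv_set R (range (coeff h))"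
  proof (rule gv_set_superset[OF S _ finite_range_coeff])
    show "S \<subseteq> range (coeff h)"
      by (auto simp: coeff_h in_set_conv_nth simp flip: xs intro!: range_eqI)
    show "range (coeff h) \<subseteq> R"
      using gv_set_mem[OF S] zero_mem by (auto simp: coeff_h simp flip: xs)
  qed
  then have h: "h \<in> N_v R"
    by (simp add: N_v_iff)
  have "z * const (coeff h i) \<in> P" for i
    using z submod_0[OF P] by (auto simp: coeff_h simp flip: xs)
  moreover have "submod (poly_ring R) P"
    using P poly_ring_le_Na_v by (auto simp: submod_def)
  ultimately have "z * to_fract h \<in> P"
    by (rule to_fract_mult_mem[rotated])
  moreover have "to_fract 1 / to_fract h \<in> Na_v R"
    using h N_v_D(1)[OF one_mem_N_v] unfolding Na_v_iff by blast
  ultimately have "to_fract 1 / to_fract h * (z * to_fract h) \<in> P"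
    by (rule submod_mult[OF P, rotated])
  then show ?thesis
    using N_v_D(2)[OF h] by simp
qed

text \<open>Unlike in the polynomial ring, the target needs no w-closure, since modules over the
  Nagata ring absorb GV-sets of \<open>R\<close>.\<close>

lemma const_w_op_mem_Na:
  assumes A: "A \<in> nz_ideals R" and x: "x \<in> w_op R A"
  shows "const x \<in> Na.extend A"
proof -
  obtain S where S: "gv_set R S" "\<forall>s\<in>S. x * s \<in> A"
    using x w_op_iff[OF A] by blast
  show ?thesis
  proof (rule Na_v_gv_set_closed[OF S(1) submod_submod_hull])
    fix s assume "s \<in> S"
    then show "const x * const s \<in> Na.extend A"
      using S(2) Na.const_mem_extend[of "x * s" A] by (simp add: const_mult)
  qed
qed

lemma Na_extend_le:
  assumes A: "A \<in> nz_ideals R" and B: "B \<in> nz_ideals R" and eq: "w_op R A = w_op R B"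
  shows "Na.extend A \<subseteq> Na.extend B"
  using const_w_op_mem_Na[OF B] w_op_extensive[OF A] eq
  by (intro Na.extend_le submod_submod_hull) auto

lemma vN_regular_extend:
  assumes I: "I \<in> nz_ideals R" and w: "w_regular R I"
  shows "vN_regular (Na_v R) (Na.extend I)"
proof -
  obtain J where J: "J \<in> nz_ideals R" and eq: "w_op R I = w_op R (ideal_prod R (ideal_prod R I I) J)"
    using w by (auto simp: w_regular_def)
  note P = ideal_prod_nz_ideals[OF ideal_prod_nz_ideals[OF I I] J]
  show ?thesis
    unfolding vN_regular_def
  proof (rule bexI[OF _ Na.extend_nz_ideals[OF J]])
    show "Na.extend I =
      ideal_prod (Na_v R) (ideal_prod (Na_v R) (Na.extend I) (Na.extend I)) (Na.extend J)"
      unfolding Na.ideal_prod_extend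
      using Na_extend_le[OF I P eq] Na_extend_le[OF P I eq[symmetric]] by blast
  qed
qed

text \<open>Constants from \<open>L\<close> already lie in the extension of \<open>I\<close>, so
  \<open>x L L \<subseteq> L\<close> transfers at once. The image of the GV-set in the product then
  forces 1 into it.\<close>

lemma stable_ideal_extend:
  assumes I: "I \<in> nz_ideals R" and w: "w_stable R I"
  shows "stable_ideal (Na_v R) (Na.extend I)"
proof -
  define L where "L = w_op R I"
  let ?H = "Na.extend I"
  note H = Na.extend_nz_ideals[OF I]
  have LH: "const a \<in> ?H" if "a \<in> L" for a
    using const_w_op_mem_Na[OF I] that by (simp add: L_def)
  have IL: "I \<subseteq> L"
    unfolding L_def by (rule w_op_extensive[OF I])
  have "const x \<in> colon (Na_v R) (endo (Na_v R) ?H) ?H"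
    if x: "x \<in> colon R (endo R L) L" for x
  proof -
    have "const x \<in> quot_field (Na_v R)"
      using x by (intro Na.const_quot) (simp add: colon_def)
    then show ?thesis
      using Na.const_colon_endo_mult_mem[OF nz_ideals_submod[OF H] IL LH x]
        nz_ideals_quot[OF H] Na.T.quot_mult
      by (simp add: colon_def endo_def)
  qed
  then have P: "const y \<in> ideal_prod (Na_v R) ?H (colon (Na_v R) (endo (Na_v R) ?H) ?H)"
    if "y \<in> ideal_prod R L (colon R (endo R L) L)" for y
    using Na.const_ideal_prod_colon_endo[OF LH _ that] by blast
  obtain S where S: "gv_set R S" "S \<subseteq> ideal_prod R L (colon R (endo R L) L)"
    by (rule w_stable_gv_set[OF I w L_def])
  show ?thesis
  proof (rule Na.T.stable_idealI[OF nz_ideals_submod[OF H]])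
    show "1 \<in> ideal_prod (Na_v R) ?H (colon (Na_v R) (endo (Na_v R) ?H) ?H)"
    proof (rule Na_v_gv_set_closed[OF S(1) submod_ideal_prod])
      fix s assume "s \<in> S"
      then show "1 * const s \<in> ideal_prod (Na_v R) ?H (colon (Na_v R) (endo (Na_v R) ?H) ?H)"
        using P S(2) by auto
    qed
  qed
qed

end

section \<open>Assembly of the four claims\<close>

theorem proposition3p3:
  fixes D :: "'k::field set"
  assumes "is_domain D"
    and not_field: "\<exists>d\<in>D. d \<noteq> 0 \<and> inverse d \<notin> D"
  shows "(Clifford_w_regular D \<longrightarrow>
            (\<forall>I\<in>extended_ideals D (poly_ring D). I \<noteq> {0} \<longrightarrow> w_regular (poly_ring D) I) \<and>
            (\<forall>I\<in>extended_ideals D (Na_v D). I \<noteq> {0} \<longrightarrow> vN_regular (Na_v D) I)) \<and>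
         (w_stable_domain D \<longrightarrow>
            (\<forall>I\<in>extended_ideals D (poly_ring D). I \<noteq> {0} \<longrightarrow> w_stable (poly_ring D) I) \<and>
            (\<forall>I\<in>extended_ideals D (Na_v D). I \<noteq> {0} \<longrightarrow> stable_ideal (Na_v D) I))"
proof -
  interpret proper_domain D
    by unfold_locales fact+
  show ?thesis
  proof (intro conjI impI ballI)
    fix I assume D: "Clifford_w_regular D"
    {
      assume "I \<in> extended_ideals D (poly_ring D)" "I \<noteq> {0}"
      then show "w_regular (poly_ring D) I"
        by (rule poly.extended_idealsE)
          (use D w_regular_extend in \<open>simp add: Clifford_w_regular_def\<close>)
    next
      assume "I \<in> extended_ideals D (Na_v D)" "I \<noteq> {0}"
      then show "vN_regular (Na_v D) I"
        by (rule Na.extended_idealsE)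
          (use D vN_regular_extend in \<open>simp add: Clifford_w_regular_def\<close>)
    }
  next
    fix I assume D: "w_stable_domain D"
    {
      assume "I \<in> extended_ideals D (poly_ring D)" "I \<noteq> {0}"
      then show "w_stable (poly_ring D) I"
        by (rule poly.extended_idealsE)
          (use D w_stable_extend in \<open>simp add: w_stable_domain_def\<close>)
    next
      assume "I \<in> extended_ideals D (Na_v D)" "I \<noteq> {0}"
      then show "stable_ideal (Na_v D) I"
        by (rule Na.extended_idealsE)
          (use D stable_ideal_extend in \<open>simp add: w_stable_domain_def\<close>)
    }
  qed
qed

end
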